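(* Let $q$ be a prime power, $\ell\geq 2$, and let $\mathcal{A}$ be a central hyperplane arrangement in $\mathbb{F}_q^\ell$. If $\chi(\mathcal{A},q^{\ell-2})=0$, then $\mathcal{A}$ is free with exponents $(1,q,q^2,\dots,q^{\ell-2},\ |\mathcal{A}|-1-q-q^2-\cdots-q^{\ell-2})$.
   Context: A (central) hyperplane arrangement $\mathcal{A}$ in $V=\mathbb{K}^\ell$ is a finite set of codimension-one linear subspaces. Characteristic polynomial: $\chi(\mathcal{A},t)=\sum_{X\in L(\mathcal{A})}\mu(X)t^{\dim X}$, where $L(\mathcal{A})$ is the set of intersections of subsets of $\mathcal{A}$ (including $V$) ordered by reverse inclusion with minimum $\hat0=V$, and $\mu(\hat0)=1$, $\mu(X)=-\sum_{Y<X}\mu(Y)$ for $X>\hat0$. Let $S=\mathbb{K}[x_1,\dots,x_\ell]$, fix for each $H\in\mathcal{A}$ a nonzero linear form $\alpha_H$ with kernel $H$; $D(\mathcal{A})=\{\delta\in \mathrm{Der}_V : \delta(\alpha_H)\in\alpha_H S\ \forall H\in\mathcal{A}\}$, where $\mathrm{Der}_V=\bigoplus_i S\,\partial/\partial x_i$. $\mathcal{A}$ is free if $D(\mathcal{A})$ is a free $S$-module; the exponents are the multiset of degrees of a homogeneous basis. *)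

theory Defs
  imports "HOL-Analysis.Cartesian_Space" "HOL-Library.Poly_Mapping" "HOL-Computational_Algebra.Polynomial"
begin

definition lin_ker :: "'a::field ^ 'n \<Rightarrow> ('a ^ 'n) set" where
  "lin_ker a = {x. (\<Sum>i\<in>UNIV. a $ i * x $ i) = 0}"

definition is_hyperplane :: "('a::field ^ 'n) set \<Rightarrow> bool" where
  "is_hyperplane H \<longleftrightarrow> (\<exists>a. a \<noteq> 0 \<and> H = lin_ker a)"

definition central_arrangement :: "('a::field ^ 'n) set set \<Rightarrow> bool" where
  "central_arrangement A \<longleftrightarrow> finite A \<and> (\<forall>H\<in>A. is_hyperplane H)"

definition int_lattice :: "('a::field ^ 'n) set set \<Rightarrow> ('a ^ 'n) set set" where
  "int_lattice A = {\<Inter>B | B. B \<subseteq> A}"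

text \<open>Moebius function of L(A), ordered by reverse inclusion (X < Y iff Y is a proper subset of X):
  mu(V) = 1 and mu(X) = - sum_{Y<X} mu(Y); extended by 0 outside L(A).\<close>
definition moebius :: "('a::field ^ 'n) set set \<Rightarrow> ('a ^ 'n) set \<Rightarrow> int" where
  "moebius A = (THE f. f UNIV = 1
      \<and> (\<forall>X\<in>int_lattice A. X \<noteq> UNIV \<longrightarrow> f X = - (\<Sum>Y\<in>{Y\<in>int_lattice A. X \<subset> Y}. f Y))
      \<and> (\<forall>X. X \<notin> int_lattice A \<longrightarrow> f X = 0))"

definition char_poly :: "('a::field ^ 'n) set set \<Rightarrow> int poly" where
  "char_poly A = (\<Sum>X\<in>int_lattice A. monom (moebius A X) (vec.dim X))"

type_synonym ('a, 'n) mpoly = "('n \<Rightarrow>\<^sub>0 nat) \<Rightarrow>\<^sub>0 'a"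

text \<open>A derivation sum_i f_i d/dx_i in Der_V, represented by its coefficient vector (f_i)_i.\<close>
type_synonym ('a, 'n) deriv = "'n \<Rightarrow> ('a, 'n) mpoly"

definition mconst :: "'a::zero \<Rightarrow> ('a, 'n) mpoly" where
  "mconst c = Poly_Mapping.single 0 c"

definition mvar :: "'n \<Rightarrow> ('a::{zero,one}, 'n) mpoly" where
  "mvar i = Poly_Mapping.single (Poly_Mapping.single i 1) 1"

definition lin_poly :: "'a::field ^ 'n \<Rightarrow> ('a, 'n) mpoly" where
  "lin_poly a = (\<Sum>i\<in>UNIV. mconst (a $ i) * mvar i)"

definition apply_deriv_lin :: "('a::field, 'n::finite) deriv \<Rightarrow> 'a ^ 'n \<Rightarrow> ('a, 'n) mpoly" where
  "apply_deriv_lin \<delta> a = (\<Sum>i\<in>UNIV. mconst (a $ i) * \<delta> i)"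

definition alpha :: "('a::field ^ 'n) set \<Rightarrow> 'a ^ 'n" where
  "alpha H = (SOME a. a \<noteq> 0 \<and> H = lin_ker a)"

definition logder :: "('a::field ^ 'n::finite) set set \<Rightarrow> ('a, 'n) deriv set" where
  "logder A = {\<delta>. \<forall>H\<in>A. lin_poly (alpha H) dvd apply_deriv_lin \<delta> (alpha H)}"

definition mon_deg :: "('n \<Rightarrow>\<^sub>0 nat) \<Rightarrow> nat" where
  "mon_deg m = (\<Sum>i\<in>Poly_Mapping.keys m. Poly_Mapping.lookup m i)"

definition homogeneous_deriv :: "('a::zero, 'n) deriv \<Rightarrow> nat \<Rightarrow> bool" where
  "homogeneous_deriv \<theta> d \<longleftrightarrow> (\<exists>i. \<theta> i \<noteq> 0) \<and> (\<forall>i. \<forall>m\<in>Poly_Mapping.keys (\<theta> i). mon_deg m = d)"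

definition deriv_comb :: "('a::field, 'n) mpoly list \<Rightarrow> ('a, 'n) deriv list \<Rightarrow> ('a, 'n) deriv" where
  "deriv_comb cs ths = (\<lambda>i. (\<Sum>j<length ths. cs ! j * (ths ! j) i))"

definition is_S_basis :: "('a::field, 'n) deriv set \<Rightarrow> ('a, 'n) deriv list \<Rightarrow> bool" where
  "is_S_basis M ths \<longleftrightarrow> set ths \<subseteq> M
     \<and> (\<forall>cs. length cs = length ths \<longrightarrow> (\<forall>i. deriv_comb cs ths i = 0) \<longrightarrow> (\<forall>c\<in>set cs. c = 0))
     \<and> (\<forall>\<theta>\<in>M. \<exists>cs. length cs = length ths \<and> \<theta> = deriv_comb cs ths)"

definition free_with_exponents :: "('a::field ^ 'n::finite) set set \<Rightarrow> int multiset \<Rightarrow> bool" where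
  "free_with_exponents A E \<longleftrightarrow> (\<exists>ths ds. length ds = length ths
      \<and> (\<forall>j<length ths. homogeneous_deriv (ths ! j) (ds ! j))
      \<and> is_S_basis (logder A) ths
      \<and> mset (map int ds) = E)"

end

theory Submission
  imports Defs "HOL-Computational_Algebra.Factorial_Ring"
begin

text \<open>
  By the theorem of Crapo and Rota, \<open>\<chi>(A, q^(\<ell>-2))\<close> counts the \<open>(\<ell>-2)\<close>-tuples of vectors contained in
  no hyperplane of \<open>A\<close>. If it vanishes, then dually the points of \<open>A\<close> meet every line of the
  projective space of linear forms. The arrangement of all hyperplanes is free with the basis
  \<open>\<theta>\<^sub>k = \<Sum>\<^sub>i x\<^sub>i^(q^k) \<partial>\<^sub>i\<close> for \<open>k < \<ell>\<close>: by induction on the dimension, a derivation which is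
  logarithmic for all hyperplanes is a \<open>q\<close>-polynomial in the linear forms. From it the hyperplanes
  outside \<open>A\<close> are deleted one at a time. If \<open>\<theta>\<^sub>0, \<dots>, \<theta>\<^bsub>\<ell>-2\<^esub>, \<theta>\<close> is a basis before the deletion of
  \<open>ker \<alpha>\<close>, then, as every line through \<open>\<alpha>\<close> still meets the arrangement, the restriction of \<open>\<theta>\<close> to
  \<open>ker \<alpha>\<close> is logarithmic for the full arrangement of \<open>ker \<alpha>\<close>. Hence
  \<open>\<theta> = \<Sum>\<^sub>k c\<^sub>k \<theta>\<^sub>k + \<alpha> \<theta>'\<close>, and replacing \<open>\<theta>\<close> by \<open>\<theta>'\<close> gives a basis after the deletion, with the
  last exponent lowered by one.
\<close>

section \<open>Substitution homomorphisms\<close>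

definition eval_monom :: "('n \<Rightarrow> 'b::comm_monoid_mult) \<Rightarrow> ('n \<Rightarrow>\<^sub>0 nat) \<Rightarrow> 'b" where
  "eval_monom \<rho> m = (\<Prod>i\<in>Poly_Mapping.keys m. \<rho> i ^ Poly_Mapping.lookup m i)"

text \<open>The algebra homomorphism with x_i sent to \<open>\<rho> i\<close>. The target has its
  own variable type because it serves both to renumber the variables and to eliminate one.\<close>

definition msubst :: "('n \<Rightarrow> ('a::comm_ring_1, 'k) mpoly) \<Rightarrow> ('a, 'n) mpoly \<Rightarrow> ('a, 'k) mpoly" where
  "msubst \<rho> f = (\<Sum>m\<in>Poly_Mapping.keys f. mconst (Poly_Mapping.lookup f m) * eval_monom \<rho> m)"

lemma eval_monom_superset:
  assumes "finite K" "Poly_Mapping.keys m \<subseteq> K"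
  shows "eval_monom \<rho> m = (\<Prod>i\<in>K. \<rho> i ^ Poly_Mapping.lookup m i)"
  unfolding eval_monom_def
  by (rule prod.mono_neutral_left) (use assms in \<open>auto simp: in_keys_iff\<close>)

lemma eval_monom_add: "eval_monom \<rho> (m + m') = eval_monom \<rho> m * eval_monom \<rho> m'"
proof -
  let ?K = "Poly_Mapping.keys m \<union> Poly_Mapping.keys m'"
  have "eval_monom \<rho> (m + m') = (\<Prod>i\<in>?K. \<rho> i ^ Poly_Mapping.lookup (m + m') i)"
    by (rule eval_monom_superset) (use keys_add[of m m'] in auto)
  moreover have "eval_monom \<rho> m = (\<Prod>i\<in>?K. \<rho> i ^ Poly_Mapping.lookup m i)"
    by (rule eval_monom_superset) auto
  moreover have "eval_monom \<rho> m' = (\<Prod>i\<in>?K. \<rho> i ^ Poly_Mapping.lookup m' i)"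
    by (rule eval_monom_superset) auto
  ultimately show ?thesis
    by (simp add: lookup_add power_add prod.distrib)
qed

lemma eval_monom_zero [simp]: "eval_monom \<rho> 0 = 1"
  by (simp add: eval_monom_def)

lemma eval_monom_single [simp]: "eval_monom \<rho> (Poly_Mapping.single i k) = \<rho> i ^ k"
  by (simp add: eval_monom_def)

section \<open>Constants, expansion into monomials, multiplicativity of substitution\<close>

lemma mconst_0 [simp]: "mconst 0 = 0"
  and mconst_1 [simp]: "mconst 1 = 1"
  by (simp_all add: mconst_def)

lemma mconst_add: "mconst (a + b :: 'a::monoid_add) = mconst a + mconst b"
  by (simp add: mconst_def single_add)

lemma mconst_uminus: "mconst (- a :: 'a::ab_group_add) = - mconst a"
  by (simp add: mconst_def single_uminus)

lemma mconst_mult: "mconst (a * b :: 'a::semiring_0) = mconst a * mconst b"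
  by (simp add: mconst_def mult_single)

lemma mconst_power: "mconst (a ^ k :: 'a::semiring_1) = mconst a ^ k"
  by (induction k) (simp_all add: mconst_mult)

lemma mconst_inject [simp]: "mconst a = mconst b \<longleftrightarrow> a = b"
  by (metis mconst_def lookup_single_eq)

lemma mpoly_sum_singles:
  "(f :: 'm \<Rightarrow>\<^sub>0 'a::comm_monoid_add) = (\<Sum>m\<in>Poly_Mapping.keys f. Poly_Mapping.single m (Poly_Mapping.lookup f m))"
proof (rule poly_mapping_eqI)
  fix k
  have "(\<Sum>m\<in>Poly_Mapping.keys f. Poly_Mapping.lookup (Poly_Mapping.single m (Poly_Mapping.lookup f m)) k)
    = (\<Sum>m\<in>Poly_Mapping.keys f. if m = k then Poly_Mapping.lookup f m else 0)"
    by (intro sum.cong) (auto simp: lookup_single)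
  also have "\<dots> = Poly_Mapping.lookup f k"
    by (simp add: in_keys_iff)
  finally show "Poly_Mapping.lookup f k
    = Poly_Mapping.lookup (\<Sum>m\<in>Poly_Mapping.keys f. Poly_Mapping.single m (Poly_Mapping.lookup f m)) k"
    by (simp add: lookup_sum)
qed

lemma additive_sum:
  fixes h :: "'b::comm_monoid_add \<Rightarrow> 'c::comm_monoid_add"
  assumes "\<And>x y. h (x + y) = h x + h y" "h 0 = 0"
  shows "h (\<Sum>i\<in>I. f i) = (\<Sum>i\<in>I. h (f i))"
  by (induction I rule: infinite_finite_induct) (auto simp: assms)

lemma msubst_superset:
  assumes "finite K" "Poly_Mapping.keys f \<subseteq> K"
  shows "msubst \<rho> f = (\<Sum>m\<in>K. mconst (Poly_Mapping.lookup f m) * eval_monom \<rho> m)"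
  unfolding msubst_def
  by (rule sum.mono_neutral_left) (use assms in \<open>auto simp: in_keys_iff\<close>)

lemma msubst_0 [simp]: "msubst \<rho> 0 = 0"
  by (simp add: msubst_def)

lemma msubst_add: "msubst \<rho> (f + g) = msubst \<rho> f + msubst \<rho> g"
proof -
  let ?K = "Poly_Mapping.keys f \<union> Poly_Mapping.keys g"
  have "msubst \<rho> (f + g) = (\<Sum>m\<in>?K. mconst (Poly_Mapping.lookup (f + g) m) * eval_monom \<rho> m)"
    by (rule msubst_superset) (use keys_add[of f g] in auto)
  moreover have "msubst \<rho> f = (\<Sum>m\<in>?K. mconst (Poly_Mapping.lookup f m) * eval_monom \<rho> m)"
    by (rule msubst_superset) auto
  moreover have "msubst \<rho> g = (\<Sum>m\<in>?K. mconst (Poly_Mapping.lookup g m) * eval_monom \<rho> m)"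
    by (rule msubst_superset) auto
  ultimately show ?thesis
    by (simp add: lookup_add mconst_add distrib_right sum.distrib)
qed

lemma msubst_single: "msubst \<rho> (Poly_Mapping.single m c) = mconst c * eval_monom \<rho> m"
  by (simp add: msubst_def)

lemma msubst_mconst [simp]: "msubst \<rho> (mconst c) = mconst c"
  using msubst_single[of \<rho> 0 c] by (simp flip: mconst_def)

lemma msubst_1 [simp]: "msubst \<rho> 1 = 1"
  using msubst_mconst[of \<rho> 1] by simp

lemma msubst_mvar [simp]: "msubst \<rho> (mvar i) = \<rho> i"
  by (simp add: mvar_def msubst_single)

lemma msubst_sum: "msubst \<rho> (\<Sum>i\<in>I. f i) = (\<Sum>i\<in>I. msubst \<rho> (f i))"
  by (rule additive_sum) (simp_all add: msubst_add)

lemma msubst_mult: "msubst \<rho> (f * g) = msubst \<rho> f * msubst \<rho> g"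
proof -
  let ?s = "\<lambda>h m. Poly_Mapping.single m (Poly_Mapping.lookup h m)"
  have "f * g = (\<Sum>m\<in>Poly_Mapping.keys f. \<Sum>k\<in>Poly_Mapping.keys g. ?s f m * ?s g k)"
    by (subst mpoly_sum_singles[of f], subst mpoly_sum_singles[of g]) (simp add: sum_product)
  then have "msubst \<rho> (f * g)
    = (\<Sum>m\<in>Poly_Mapping.keys f. \<Sum>k\<in>Poly_Mapping.keys g. msubst \<rho> (?s f m * ?s g k))"
    by (simp add: msubst_sum)
  also have "\<dots> = (\<Sum>m\<in>Poly_Mapping.keys f. \<Sum>k\<in>Poly_Mapping.keys g.
      (mconst (Poly_Mapping.lookup f m) * eval_monom \<rho> m) * (mconst (Poly_Mapping.lookup g k) * eval_monom \<rho> k))"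
    by (intro sum.cong refl) (simp add: mult_single msubst_single eval_monom_add mconst_mult mult_ac)
  also have "\<dots> = msubst \<rho> f * msubst \<rho> g"
    by (simp add: msubst_def sum_product)
  finally show ?thesis .
qed

lemma msubst_power: "msubst \<rho> (f ^ k) = msubst \<rho> f ^ k"
  by (induction k) (simp_all add: msubst_mult)

lemma msubst_diff: "msubst \<rho> (f - g) = msubst \<rho> f - msubst \<rho> g"
  using msubst_add[of \<rho> "f - g" g] by simp

lemma msubst_prod: "msubst \<rho> (\<Prod>i\<in>I. f i) = (\<Prod>i\<in>I. msubst \<rho> (f i))"
  by (induction I rule: infinite_finite_induct) (auto simp: msubst_mult)

lemma mvar_power: "mvar i ^ k = Poly_Mapping.single (Poly_Mapping.single i k) (1 :: 'a::comm_ring_1)"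
  by (induction k) (simp_all add: mvar_def mult_single flip: single_add)

lemma single_eq_eval_monom: "Poly_Mapping.single m c = mconst (c :: 'a::comm_ring_1) * eval_monom mvar m"
proof -
  have "(\<Prod>i\<in>K. mvar i ^ Poly_Mapping.lookup m i)
    = Poly_Mapping.single (\<Sum>i\<in>K. Poly_Mapping.single i (Poly_Mapping.lookup m i)) (1::'a)"
    if "finite K" for K using that
    by (induction K) (simp_all add: mvar_power mult_single)
  from this[of "Poly_Mapping.keys m"] have "eval_monom mvar m = Poly_Mapping.single m (1::'a)"
    using mpoly_sum_singles[of m] by (simp add: eval_monom_def)
  then show ?thesis
    by (simp add: mconst_def mult_single)
qed

text \<open>Every polynomial is a sum of products of constants and variable powers. Identities
  between homomorphisms and congruences thus need checking only on generators.\<close>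

lemma mpoly_induct [case_names const var add mult]:
  fixes f :: "('a::comm_ring_1, 'n) mpoly"
  assumes const: "\<And>c. P (mconst c)" and var: "\<And>i. P (mvar i)"
    and add: "\<And>f g. P f \<Longrightarrow> P g \<Longrightarrow> P (f + g)" and mult: "\<And>f g. P f \<Longrightarrow> P g \<Longrightarrow> P (f * g)"
  shows "P f"
proof -
  have sum: "P (\<Sum>i\<in>I. h i)" if "\<And>i. P (h i)" for I :: "('n \<Rightarrow>\<^sub>0 nat) set" and h
    by (induction I rule: infinite_finite_induct) (use that const[of 0] in \<open>auto intro: add\<close>)
  have pow: "P (mvar i ^ k)" for i k
    by (induction k) (use const[of 1] in \<open>auto intro: mult var\<close>)
  have prod: "P (\<Prod>i\<in>I. h i)" if "\<And>i. P (h i)" for I :: "'n set" and h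
    by (induction I rule: infinite_finite_induct) (use that const[of 1] in \<open>auto intro: mult\<close>)
  have "P (Poly_Mapping.single m c)" for m c
    unfolding single_eq_eval_monom eval_monom_def by (intro mult const prod pow)
  then show ?thesis
    by (subst mpoly_sum_singles) (rule sum)
qed

lemma msubst_msubst: "msubst \<sigma> (msubst \<rho> f) = msubst (\<lambda>i. msubst \<sigma> (\<rho> i)) f"
  by (induction f rule: mpoly_induct) (simp_all add: msubst_add msubst_mult)

lemma msubst_id [simp]: "msubst mvar f = f"
  by (induction f rule: mpoly_induct) (simp_all add: msubst_add msubst_mult)

section \<open>Polynomials in finitely many variables form a domain\<close>

text \<open>The \<open>idom\<close> instance of \<open>poly_mapping\<close> needs linearly ordered exponents, so the variables
  are numbered.\<close>

definition number_vars :: "('a::comm_ring_1, 'n::finite) mpoly \<Rightarrow> ('a, nat) mpoly" where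
  "number_vars = msubst (\<lambda>i. mvar (to_nat_on UNIV i))"

text \<open>Renumbering back with \<open>from_nat_into\<close> is a left inverse.\<close>

lemma number_vars_inject [simp]:
  fixes f g :: "('a::comm_ring_1, 'n::finite) mpoly"
  shows "number_vars f = number_vars g \<longleftrightarrow> f = g"
proof -
  have "msubst (\<lambda>k. mvar (from_nat_into (UNIV :: 'n set) k)) (number_vars f) = f" for f :: "('a, 'n) mpoly"
    by (simp add: number_vars_def msubst_msubst countable_finite)
  then show ?thesis
    by metis
qed

lemma number_vars_0 [simp]: "number_vars 0 = 0"
  by (simp add: number_vars_def)

lemma number_vars_eq_0_iff [simp]: "number_vars f = 0 \<longleftrightarrow> f = 0"
  by (metis number_vars_0 number_vars_inject)

lemma number_vars_mult: "number_vars (f * g) = number_vars f * number_vars g"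
  by (simp add: number_vars_def msubst_mult)

lemma mpoly_mult_eq_0_iff:
  fixes f g :: "('a::idom, 'n::finite) mpoly"
  shows "f * g = 0 \<longleftrightarrow> f = 0 \<or> g = 0"
proof -
  have "f * g = 0 \<longleftrightarrow> number_vars f * number_vars g = 0"
    by (simp flip: number_vars_mult)
  then show ?thesis
    by simp
qed

lemma mpoly_mult_left_cancel:
  fixes f g h :: "('a::idom, 'n::finite) mpoly"
  assumes "f \<noteq> 0" "f * g = f * h"
  shows "g = h"
proof -
  have "f * (g - h) = 0"
    using assms by (simp add: right_diff_distrib)
  then show ?thesis
    using assms by (simp add: mpoly_mult_eq_0_iff)
qed

section \<open>Homogeneous components\<close>

definition mhomog :: "nat \<Rightarrow> ('a::zero, 'n) mpoly \<Rightarrow> bool" where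
  "mhomog d f \<longleftrightarrow> (\<forall>m\<in>Poly_Mapping.keys f. mon_deg m = d)"

lift_definition hcomp :: "nat \<Rightarrow> ('a::zero, 'n) mpoly \<Rightarrow> ('a, 'n) mpoly"
  is "\<lambda>d f m. if mon_deg m = d then f m else 0"
  by (erule rev_finite_subset) auto

lemma mon_deg_superset:
  assumes "finite K" "Poly_Mapping.keys m \<subseteq> K"
  shows "mon_deg m = (\<Sum>i\<in>K. Poly_Mapping.lookup m i)"
  unfolding mon_deg_def
  by (rule sum.mono_neutral_left) (use assms in \<open>auto simp: in_keys_iff\<close>)

lemma mon_deg_add: "mon_deg (m + m') = mon_deg m + mon_deg m'"
proof -
  let ?K = "Poly_Mapping.keys m \<union> Poly_Mapping.keys m'"
  have "mon_deg (m + m') = (\<Sum>i\<in>?K. Poly_Mapping.lookup (m + m') i)"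
    by (rule mon_deg_superset) (use keys_add[of m m'] in auto)
  moreover have "mon_deg m = (\<Sum>i\<in>?K. Poly_Mapping.lookup m i)"
    by (rule mon_deg_superset) auto
  moreover have "mon_deg m' = (\<Sum>i\<in>?K. Poly_Mapping.lookup m' i)"
    by (rule mon_deg_superset) auto
  ultimately show ?thesis
    by (simp add: lookup_add sum.distrib)
qed

lemma mhomog_0 [simp]: "mhomog d 0"
  by (simp add: mhomog_def)

lemma mhomog_mconst [simp]: "mhomog 0 (mconst c)"
  by (simp add: mhomog_def mconst_def mon_deg_def)

lemma mhomog_mult:
  fixes f g :: "('a::comm_ring_1, 'n) mpoly"
  assumes "mhomog d f" "mhomog e g"
  shows "mhomog (d + e) (f * g)"
  using assms keys_mult[of f g] by (auto simp: mhomog_def mon_deg_add)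

lemma mhomog_add:
  fixes f g :: "('a::comm_ring_1, 'n) mpoly"
  assumes "mhomog d f" "mhomog d g"
  shows "mhomog d (f + g)"
  using assms keys_add[of f g] by (auto simp: mhomog_def)

lemma mhomog_sum:
  fixes f :: "'i \<Rightarrow> ('a::comm_ring_1, 'n) mpoly"
  assumes "\<And>i. i \<in> I \<Longrightarrow> mhomog d (f i)"
  shows "mhomog d (\<Sum>i\<in>I. f i)"
  using assms by (induction I rule: infinite_finite_induct) (auto intro: mhomog_add)

lemma mhomog_mvar_power: "mhomog k (mvar i ^ k :: ('a::comm_ring_1, 'n) mpoly)"
  by (auto simp: mvar_power mhomog_def mon_deg_def)

lemma mhomog_lin_poly: "mhomog 1 (lin_poly a)"
  unfolding lin_poly_def
  by (intro mhomog_sum) (metis add.left_neutral mhomog_mconst mhomog_mult mhomog_mvar_power power_one_right)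

lemma mhomog_hcomp: "mhomog d (hcomp d f)"
  unfolding mhomog_def by transfer auto

lemma hcomp_add: "hcomp d (f + g :: ('a::comm_ring_1, 'n) mpoly) = hcomp d f + hcomp d g"
  by transfer auto

lemma hcomp_0 [simp]: "hcomp d 0 = 0"
  by transfer auto

lemma hcomp_sum: "hcomp d (\<Sum>i\<in>I. f i :: ('a::comm_ring_1, 'n) mpoly) = (\<Sum>i\<in>I. hcomp d (f i))"
  by (rule additive_sum) (simp_all add: hcomp_add)

lemma hcomp_homog: "mhomog e f \<Longrightarrow> hcomp d f = (if d = e then f else 0)"
  by (rule poly_mapping_eqI) (auto simp: hcomp.rep_eq mhomog_def in_keys_iff)

lemma sum_hcomp:
  fixes f :: "('a::comm_ring_1, 'n) mpoly"
  obtains D where "finite D" "f = (\<Sum>d\<in>D. hcomp d f)"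
proof
  let ?D = "mon_deg ` Poly_Mapping.keys f"
  show "finite ?D"
    by simp
  show "f = (\<Sum>d\<in>?D. hcomp d f)"
    by (rule poly_mapping_eqI) (auto simp: lookup_sum hcomp.rep_eq in_keys_iff sum.delta')
qed

text \<open>By linearity only homogeneous \<open>f\<close> matter. The case split is there because
  \<open>d - e\<close> is truncated subtraction.\<close>

lemma hcomp_mult_homog:
  fixes f g :: "('a::comm_ring_1, 'n) mpoly"
  assumes g: "mhomog e g"
  shows "hcomp d (f * g) = (if e \<le> d then hcomp (d - e) f * g else 0)"
proof -
  obtain D where D: "finite D" "f = (\<Sum>k\<in>D. hcomp k f)"
    by (rule sum_hcomp)
  have "hcomp d (hcomp k f * g) = (if e \<le> d then hcomp (d - e) (hcomp k f) * g else 0)" for k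
    using hcomp_homog[OF mhomog_mult[OF mhomog_hcomp[of k f] g], of d]
      hcomp_homog[OF mhomog_hcomp[of k f], of "d - e"] by auto
  then have "hcomp d ((\<Sum>k\<in>D. hcomp k f) * g)
      = (if e \<le> d then hcomp (d - e) (\<Sum>k\<in>D. hcomp k f) * g else 0)"
    by (simp add: sum_distrib_right hcomp_sum)
  then show ?thesis
    using D by simp
qed

section \<open>Linear forms\<close>

text \<open>Read as a coefficient vector, \<open>mvar\<close> is the Euler derivation; linearity of
  \<open>lin_poly\<close> becomes an instance of linearity of
  \<open>apply_deriv_lin\<close>.\<close>

lemma lin_poly_eq_apply: "lin_poly a = apply_deriv_lin mvar a"
  by (simp add: lin_poly_def apply_deriv_lin_def)

lemma apply_deriv_lin_add: "apply_deriv_lin \<delta> (a + b) = apply_deriv_lin \<delta> a + apply_deriv_lin \<delta> b"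
  by (simp add: apply_deriv_lin_def mconst_add distrib_right sum.distrib)

lemma apply_deriv_lin_scale: "apply_deriv_lin \<delta> (c *s a) = mconst c * apply_deriv_lin \<delta> a"
  by (simp add: apply_deriv_lin_def mconst_mult sum_distrib_left mult.assoc)

lemma apply_deriv_lin_0 [simp]: "apply_deriv_lin \<delta> 0 = 0"
  by (simp add: apply_deriv_lin_def)

lemma apply_deriv_lin_axis [simp]: "apply_deriv_lin \<delta> (axis i 1) = \<delta> i"
proof -
  have "apply_deriv_lin \<delta> (axis i 1) = (\<Sum>k\<in>UNIV. if k = i then \<delta> k else 0)"
    unfolding apply_deriv_lin_def by (intro sum.cong) (auto simp: axis_def)
  then show ?thesis
    by simp
qed

lemma apply_deriv_lin_fun_diff:
  "apply_deriv_lin (\<lambda>i. \<delta> i - \<epsilon> i) a = apply_deriv_lin \<delta> a - apply_deriv_lin \<epsilon> a"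
  by (simp add: apply_deriv_lin_def right_diff_distrib sum_subtractf)

lemma apply_deriv_lin_fun_add:
  "apply_deriv_lin (\<lambda>i. \<delta> i + \<epsilon> i) a = apply_deriv_lin \<delta> a + apply_deriv_lin \<epsilon> a"
  by (simp add: apply_deriv_lin_def distrib_left sum.distrib)

lemma apply_deriv_lin_fun_mult:
  "apply_deriv_lin (\<lambda>i. f * \<delta> i) a = f * apply_deriv_lin \<delta> a"
  by (simp add: apply_deriv_lin_def sum_distrib_left mult_ac)

lemma apply_deriv_lin_fun_sum:
  "apply_deriv_lin (\<lambda>i. \<Sum>k\<in>K. \<delta> k i) a = (\<Sum>k\<in>K. apply_deriv_lin (\<delta> k) a)"
  unfolding apply_deriv_lin_def by (subst sum.swap) (simp add: sum_distrib_left)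

lemmas lin_poly_add = apply_deriv_lin_add[of mvar, folded lin_poly_eq_apply]
  and lin_poly_scale = apply_deriv_lin_scale[of mvar, folded lin_poly_eq_apply]
  and lin_poly_0 [simp] = apply_deriv_lin_0[of mvar, folded lin_poly_eq_apply]
  and lin_poly_axis [simp] = apply_deriv_lin_axis[of mvar, folded lin_poly_eq_apply]

lemma lookup_lin_poly: "Poly_Mapping.lookup (lin_poly a) (Poly_Mapping.single i 1) = a $ i"
proof -
  have "Poly_Mapping.single k (Suc 0) = Poly_Mapping.single i (Suc 0) \<longleftrightarrow> k = i" for k
    by (metis keys_single nat.simps(3) singleton_inject)
  then have "Poly_Mapping.lookup (lin_poly a) (Poly_Mapping.single i 1)
    = (\<Sum>k\<in>UNIV. if k = i then a $ k else 0)"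
    unfolding lin_poly_def lookup_sum
    by (intro sum.cong) (auto simp: mconst_def mvar_def mult_single lookup_single)
  then show ?thesis
    by simp
qed

lemma lin_poly_inject [simp]: "lin_poly a = lin_poly b \<longleftrightarrow> a = b"
  by (metis lookup_lin_poly vec_eq_iff)

lemma lin_poly_eq_0_iff [simp]: "lin_poly a = 0 \<longleftrightarrow> a = 0"
  by (metis lin_poly_0 lin_poly_inject)

text \<open>The substitution eliminating \<open>x\<^sub>j\<close> with the help of the equation \<open>lin_poly a = 0\<close>
  realises the quotient by \<open>lin_poly a\<close> inside the polynomial ring.\<close>

definition elim_subst :: "'a::field ^ 'n::finite \<Rightarrow> 'n \<Rightarrow> 'n \<Rightarrow> ('a, 'n) mpoly" where
  "elim_subst a j i = mvar i - (if i = j then mconst (inverse (a $ j)) * lin_poly a else 0)"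

definition elim_var :: "'a::field ^ 'n::finite \<Rightarrow> 'n \<Rightarrow> ('a, 'n) mpoly \<Rightarrow> ('a, 'n) mpoly" where
  "elim_var a j = msubst (elim_subst a j)"

lemma elim_var_hom:
  "elim_var a j (f + g) = elim_var a j f + elim_var a j g"
  "elim_var a j (f - g) = elim_var a j f - elim_var a j g"
  "elim_var a j (f * g) = elim_var a j f * elim_var a j g"
  "elim_var a j (f ^ k) = elim_var a j f ^ k"
  "elim_var a j (\<Sum>i\<in>I. h i) = (\<Sum>i\<in>I. elim_var a j (h i))"
  "elim_var a j (mconst c) = mconst c"
  by (simp_all add: elim_var_def msubst_add msubst_diff msubst_mult msubst_power msubst_sum)

lemma elim_var_mvar:
  "elim_var a j (mvar i) = mvar i - (if i = j then mconst (inverse (a $ j)) * lin_poly a else 0)"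
  by (simp add: elim_var_def elim_subst_def)

lemma elim_var_0 [simp]: "elim_var a j 0 = 0"
  by (simp add: elim_var_def)

lemma elim_var_1 [simp]: "elim_var a j 1 = 1"
  by (simp add: elim_var_def)

lemma elim_var_apply_deriv_lin:
  "elim_var a j (apply_deriv_lin \<delta> b) = apply_deriv_lin (\<lambda>i. elim_var a j (\<delta> i)) b"
  by (simp add: apply_deriv_lin_def elim_var_hom)

text \<open>Only x_j is changed, and it occurs in \<open>b\<close> with coefficient
  \<open>b $ j\<close>. So forms without x_j are fixed, and for \<open>a $ j \<noteq> 0\<close> the
  form of \<open>a\<close> goes to 0.\<close>

lemma elim_var_lin_poly:
  "elim_var a j (lin_poly b) = lin_poly b - mconst (b $ j * inverse (a $ j)) * lin_poly a"
proof -
  have "elim_var a j (lin_poly b)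
    = lin_poly b - (\<Sum>i\<in>UNIV. if i = j then mconst (b $ j * inverse (a $ j)) * lin_poly a else 0)"
    unfolding lin_poly_eq_apply elim_var_apply_deriv_lin elim_var_mvar apply_deriv_lin_fun_diff
    unfolding apply_deriv_lin_def
    by (intro arg_cong2[where f = minus] sum.cong refl) (auto simp: mconst_mult mult_ac)
  then show ?thesis
    by simp
qed

text \<open>A homomorphism that is the identity modulo \<open>lin_poly a\<close> on the generators
  is so everywhere.\<close>

lemma dvd_diff_elim_var: "lin_poly a dvd f - elim_var a j f"
proof (induction f rule: mpoly_induct)
  case (mult f g)
  have "f * g - elim_var a j (f * g) = (f - elim_var a j f) * g + elim_var a j f * (g - elim_var a j g)"
    by (simp add: elim_var_hom algebra_simps)
  then show ?case
    using mult by (metis dvd_add dvd_mult dvd_mult2)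
next
  case (add f g)
  have "f + g - elim_var a j (f + g) = (f - elim_var a j f) + (g - elim_var a j g)"
    by (simp add: elim_var_hom)
  then show ?case
    using add by (metis dvd_add)
qed (auto simp: elim_var_hom elim_var_mvar)

context
  fixes a :: "'a::field ^ 'n::finite" and j :: 'n
  assumes aj: "a $ j \<noteq> 0"
begin

lemma elim_var_self [simp]: "elim_var a j (lin_poly a) = 0"
  using aj by (simp add: elim_var_lin_poly)

text \<open>The kernel is the ideal of \<open>lin_poly a\<close>: the homomorphism kills this form
  and is the identity modulo it.\<close>

lemma lin_poly_dvd_iff: "lin_poly a dvd f \<longleftrightarrow> elim_var a j f = 0"
proof
  assume "lin_poly a dvd f"
  then show "elim_var a j f = 0"
    by (auto elim!: dvdE simp: elim_var_hom)
next
  assume "elim_var a j f = 0"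
  then show "lin_poly a dvd f"
    using dvd_diff_elim_var[of a f j] by simp
qed

lemma elim_var_idem [simp]: "elim_var a j (elim_var a j f) = elim_var a j f"
  using dvd_diff_elim_var[of a f j] by (simp add: lin_poly_dvd_iff elim_var_hom)

end

section \<open>Linear forms as primes, associated only if proportional\<close>

lemma vec_nonzero_nth:
  assumes "a \<noteq> (0 :: 'a::zero ^ 'n)"
  obtains j where "a $ j \<noteq> 0"
  using assms by (auto simp: vec_eq_iff)

text \<open>The ideal it generates is the kernel of a homomorphism into a domain.\<close>

lemma prime_elem_lin_poly:
  assumes "a \<noteq> 0"
  shows "prime_elem (lin_poly a)"
proof -
  obtain j where "a $ j \<noteq> 0"
    using assms by (rule vec_nonzero_nth)
  note dvd = lin_poly_dvd_iff[OF this]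
  show ?thesis
    unfolding prime_elem_def
    using assms by (simp add: dvd elim_var_hom mpoly_mult_eq_0_iff)
qed

lemma lin_poly_dvd_lin_polyD:
  assumes "a \<noteq> 0" "lin_poly a dvd lin_poly b"
  obtains c where "b = c *s a"
proof -
  obtain j where "a $ j \<noteq> 0"
    using assms(1) by (rule vec_nonzero_nth)
  then have "lin_poly b = lin_poly ((b $ j * inverse (a $ j)) *s a)"
    using assms(2) by (simp add: lin_poly_dvd_iff elim_var_lin_poly lin_poly_scale)
  then show ?thesis
    using that by (simp only: lin_poly_inject)
qed

text \<open>Each new prime divides the earlier product times its cofactor but no earlier factor,
  hence it divides the cofactor.\<close>

lemma prod_prime_elem_dvd:
  assumes "finite I" "\<And>i. i \<in> I \<Longrightarrow> prime_elem (p i)" "\<And>i. i \<in> I \<Longrightarrow> p i dvd f"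
    and "\<And>i k. i \<in> I \<Longrightarrow> k \<in> I \<Longrightarrow> i \<noteq> k \<Longrightarrow> \<not> p i dvd p k"
  shows "(\<Prod>i\<in>I. p i) dvd f"
  using assms
proof (induction I)
  case (insert i I)
  then obtain g where g: "f = (\<Prod>i\<in>I. p i) * g"
    by (auto elim!: dvdE)
  have prime: "prime_elem (p i)" and ndvd: "\<And>k. k \<in> I \<Longrightarrow> \<not> p i dvd p k"
    using insert.prems insert.hyps by auto
  have "\<not> p i dvd (\<Prod>k\<in>K. p k)" if "K \<subseteq> I" for K
    using finite_subset[OF that insert.hyps(1)] that
  proof (induction K)
    case empty
    then show ?case
      using prime by (simp add: prime_elem_def)
  next
    case (insert k K)
    then show ?case
      using prime ndvd
      by (auto dest!: prime_elem_dvd_multD)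
  qed
  then have "p i dvd g"
    using insert.prems(2)[of i] prime g by (auto dest: prime_elem_dvd_multD)
  then show ?case
    using g insert.hyps by (auto elim!: dvdE simp: mult_ac)
qed simp

section \<open>Frobenius and \<open>q\<close>-polynomials\<close>

lemma CARD_field_gt_1: "1 < CARD('a::{field,finite})"
proof -
  have "card {0, 1 :: 'a} \<le> CARD('a)"
    by (intro card_mono) auto
  then show ?thesis
    by simp
qed

text \<open>Multiplication by a nonzero x permutes the nonzero elements; comparing their products
  gives x^(q-1) = 1.\<close>

lemma power_CARD_eq_self: "(x :: 'a::{field,finite}) ^ CARD('a) = x"
proof (cases "x = 0")
  case False
  have "(\<Prod>y\<in>UNIV - {0}. y) = (\<Prod>y\<in>UNIV - {0}. x * y)"
    by (rule prod.reindex_bij_witness[of _ "\<lambda>y. x * y" "\<lambda>y. y / x"]) (use False in auto)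
  also have "\<dots> = x ^ (CARD('a) - 1) * (\<Prod>y\<in>UNIV - {0}. y)"
    by (simp add: prod.distrib card_Diff_singleton)
  finally have "x ^ (CARD('a) - 1) = 1"
    by simp
  then have "x ^ Suc (CARD('a) - 1) = x"
    by (simp only: power_Suc mult_1_right)
  moreover have "Suc (CARD('a) - 1) = CARD('a)"
    using CARD_field_gt_1[where 'a = 'a] by simp
  ultimately show ?thesis
    by (simp only:)
qed (use CARD_field_gt_1[where 'a = 'a] in auto)

text \<open>The polynomials \<open>(X + 1)^q\<close> and \<open>X^q + 1\<close> are monic of degree \<open>q\<close> and agree on the field.\<close>

lemma of_nat_CARD_choose_eq_0:
  assumes "0 < i" "i < CARD('a)"
  shows "of_nat (CARD('a) choose i) = (0 :: 'a::{field,finite})"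
proof -
  let ?q = "CARD('a)"
  have "[:1, 1 :: 'a:] ^ ?q = monom 1 ?q + 1"
  proof (rule poly_eqI_degree_lead_coeff[where n = ?q and A = UNIV])
    show "coeff ([:1, 1 :: 'a:] ^ ?q) ?q = coeff (monom 1 ?q + 1) ?q"
      using CARD_field_gt_1[where 'a = 'a] by (simp add: coeff_linear_power)
    show "degree ([:1, 1 :: 'a:] ^ ?q) \<le> ?q"
      by (simp add: degree_linear_power)
    show "degree (monom 1 ?q + 1 :: 'a poly) \<le> ?q"
      by (intro degree_add_le degree_monom_le) simp
  qed (simp_all add: poly_monom power_CARD_eq_self)
  from arg_cong[OF this, of "\<lambda>p. coeff p i"] show ?thesis
    using assms by (simp add: coeff_linear_poly_power coeff_1)
qed

lemma of_nat_mpoly: "of_nat k = (mconst (of_nat k) :: ('a::comm_ring_1, 'n) mpoly)"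
  by (simp add: mconst_def)

lemma mpoly_frobenius_add:
  fixes f g :: "('a::{field,finite}, 'n) mpoly"
  shows "(f + g) ^ CARD('a) = f ^ CARD('a) + g ^ CARD('a)"
proof -
  let ?q = "CARD('a)"
  let ?s = "\<lambda>k. of_nat (?q choose k) * f ^ k * g ^ (?q - k)"
  have "(f + g) ^ ?q = (\<Sum>k\<le>?q. ?s k)"
    by (rule binomial_ring)
  also have "\<dots> = (\<Sum>k\<in>{0, ?q}. ?s k)"
    by (rule sum.mono_neutral_right) (auto simp: of_nat_mpoly of_nat_CARD_choose_eq_0)
  also have "\<dots> = f ^ ?q + g ^ ?q"
    using CARD_field_gt_1[where 'a = 'a] by simp
  finally show ?thesis .
qed

lemma frobenius_power_add:
  fixes f g :: "('a::{field,finite}, 'n) mpoly"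
  shows "(f + g) ^ (CARD('a) ^ k) = f ^ (CARD('a) ^ k) + g ^ (CARD('a) ^ k)"
proof (induction k)
  case (Suc k)
  have "h ^ (CARD('a) ^ Suc k) = (h ^ (CARD('a) ^ k)) ^ CARD('a)" for h :: "('a, 'n) mpoly"
    by (simp add: mult.commute flip: power_mult)
  then show ?case
    by (simp add: Suc mpoly_frobenius_add)
qed simp

lemma frobenius_power_scale:
  fixes f :: "('a::{field,finite}, 'n) mpoly"
  shows "(mconst c * f) ^ (CARD('a) ^ k) = mconst c * f ^ (CARD('a) ^ k)"
proof -
  have "c ^ (CARD('a) ^ k) = c"
    by (induction k) (simp_all add: power_CARD_eq_self power_mult)
  then show ?thesis
    by (simp add: power_mult_distrib flip: mconst_power)
qed

lemma frobenius_sum: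
  fixes f :: "'i \<Rightarrow> ('a::{field,finite}, 'n) mpoly"
  shows "(\<Sum>i\<in>I. f i) ^ (CARD('a) ^ k) = (\<Sum>i\<in>I. f i ^ (CARD('a) ^ k))"
  by (rule additive_sum) (use CARD_field_gt_1[where 'a = 'a] in \<open>auto simp: frobenius_power_add zero_power\<close>)

definition frob_deriv :: "nat \<Rightarrow> ('a::{field,finite}, 'n::finite) deriv" where
  "frob_deriv k = (\<lambda>i. mvar i ^ (CARD('a) ^ k))"

text \<open>Taking q^k-th powers is additive and fixes the scalars. Consequently \<theta>_k is
  logarithmic for every arrangement.\<close>

lemma apply_frob_deriv:
  fixes a :: "'a::{field,finite} ^ 'n::finite"
  shows "apply_deriv_lin (frob_deriv k) a = lin_poly a ^ (CARD('a) ^ k)"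
  by (simp add: apply_deriv_lin_def frob_deriv_def lin_poly_def frobenius_sum frobenius_power_scale)

text \<open>Homogeneous version of the factorisation of X^q - X. Both sides are monic of degree q in
  t and vanish at the q points - c s, which are distinct for s \<noteq> 0.\<close>

lemma prod_add_scalar_multiples:
  fixes t s :: "('a::{field,finite}, 'n::finite) mpoly"
  shows "(\<Prod>c\<in>UNIV. t + mconst c * s) = t ^ CARD('a) - s ^ (CARD('a) - 1) * t"
proof (cases "s = 0")
  case True
  then show ?thesis
    using CARD_field_gt_1[where 'a = 'a] by (simp add: zero_power)
next
  case False
  let ?q = "CARD('a)"
  have q: "1 < ?q"
    by (rule CARD_field_gt_1)
  \<comment> \<open>Root counting takes place over the renumbered ring, which is a domain; t becomes
    the indeterminate.\<close>
  define u where "u = number_vars s"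
  let ?P = "(\<Prod>c\<in>(UNIV :: 'a set). [:mconst c * u, 1:])"
  let ?Q = "monom 1 ?q - smult (u ^ (?q - 1)) (monom 1 1)"
  have u: "u \<noteq> 0"
    using False by (simp add: u_def)
  have "?P = ?Q"
  proof (rule poly_eqI_degree_lead_coeff[where n = ?q and A = "range (\<lambda>c. - (mconst c * u))"])
    have deg: "degree ?P = ?q"
      by (subst degree_prod_eq_sum_degree) auto
    then show "degree ?P \<le> ?q"
      by simp
    have "lead_coeff ?P = 1"
      by (simp add: lead_coeff_prod)
    then show "coeff ?P ?q = coeff ?Q ?q"
      using deg q by simp
    show "degree ?Q \<le> ?q"
      using q by (intro degree_diff_le degree_monom_le order.trans[OF degree_smult_le]) 
        (auto intro: order.trans[OF degree_monom_le])
    have "inj (\<lambda>c :: 'a. - (mconst c * u))"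
      using u by (auto intro!: injI)
    then show "?q \<le> card (range (\<lambda>c :: 'a. - (mconst c * u)))"
      by (simp add: card_image)
    fix z
    assume "z \<in> range (\<lambda>c :: 'a. - (mconst c * u))"
    then obtain c :: 'a where z: "z = mconst (- c) * u"
      by (auto simp: mconst_uminus)
    have "u ^ ?q = u ^ (?q - 1) * u"
      using q by (simp flip: power_Suc2)
    then have "poly ?Q z = 0"
      by (simp add: z poly_monom power_mult_distrib power_CARD_eq_self flip: mconst_power)
    moreover have "poly ?P z = 0"
      by (auto simp: poly_prod prod_zero_iff z mconst_uminus intro!: exI[of _ c])
    ultimately show "poly ?P z = poly ?Q z"
      by simp
  qed
  from arg_cong[OF this, of "\<lambda>p. poly p (number_vars t)"]
  have "number_vars (\<Prod>c\<in>UNIV. t + mconst c * s) = number_vars (t ^ ?q - s ^ (?q - 1) * t)"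
    by (simp add: poly_prod poly_monom u_def number_vars_def msubst_prod msubst_add msubst_mult
        msubst_power msubst_diff add.commute)
  then show ?thesis
    by simp
qed

section \<open>\<open>q\<close>-polynomials, also called linearised polynomials, as
  operators\<close>

definition qpoly :: "nat \<Rightarrow> (('a::{field,finite}, 'n::finite) mpoly \<Rightarrow> ('a, 'n) mpoly) \<Rightarrow> bool" where
  "qpoly m F \<longleftrightarrow> (\<exists>e. \<forall>t. F t = (\<Sum>k<m. e k * t ^ (CARD('a) ^ k)))"

lemma qpoly_additive: "qpoly m F \<Longrightarrow> F (s + t) = F s + F t"
  by (auto simp: qpoly_def frobenius_power_add distrib_left sum.distrib)

lemma qpoly_scale: "qpoly m F \<Longrightarrow> F (mconst c * t) = mconst c * F t"
  by (auto simp: qpoly_def frobenius_power_scale sum_distrib_left mult.left_commute)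

lemma qpoly_add:
  fixes F G :: "('a::{field,finite}, 'n::finite) mpoly \<Rightarrow> ('a, 'n) mpoly"
  shows "qpoly m F \<Longrightarrow> qpoly m G \<Longrightarrow> qpoly m (\<lambda>t. F t + G t)"
  unfolding qpoly_def
proof (elim exE)
  fix e e'
  assume "\<forall>t. F t = (\<Sum>k<m. e k * t ^ (CARD('a) ^ k))" "\<forall>t. G t = (\<Sum>k<m. e' k * t ^ (CARD('a) ^ k))"
  then show "\<exists>e. \<forall>t. F t + G t = (\<Sum>k<m. e k * t ^ (CARD('a) ^ k))"
    by (intro exI[of _ "\<lambda>k. e k + e' k"]) (simp add: distrib_right sum.distrib)
qed

lemma qpoly_mult:
  fixes F :: "('a::{field,finite}, 'n::finite) mpoly \<Rightarrow> ('a, 'n) mpoly"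
  shows "qpoly m F \<Longrightarrow> qpoly m (\<lambda>t. f * F t)"
  unfolding qpoly_def
proof (elim exE)
  fix e
  assume "\<forall>t. F t = (\<Sum>k<m. e k * t ^ (CARD('a) ^ k))"
  then show "\<exists>e. \<forall>t. f * F t = (\<Sum>k<m. e k * t ^ (CARD('a) ^ k))"
    by (intro exI[of _ "\<lambda>k. f * e k"]) (simp add: sum_distrib_left mult.assoc)
qed

lemma qpoly_mono:
  fixes F :: "('a::{field,finite}, 'n::finite) mpoly \<Rightarrow> ('a, 'n) mpoly"
  assumes "qpoly m F" "m \<le> m'"
  shows "qpoly m' F"
proof -
  obtain e where e: "\<And>t. F t = (\<Sum>k<m. e k * t ^ (CARD('a) ^ k))"
    using assms by (auto simp: qpoly_def)
  have "(\<Sum>k<m. e k * t ^ (CARD('a) ^ k)) = (\<Sum>k<m'. (if k < m then e k else 0) * t ^ (CARD('a) ^ k))" for t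
    using assms(2) by (intro sum.mono_neutral_cong_left) auto
  then show ?thesis
    unfolding qpoly_def e by (intro exI allI)
qed

text \<open>Frobenius is additive and moves each coefficient, raised to the power q, from exponent
  q^k to q^(k+1); place 0 becomes empty.\<close>

lemma qpoly_frobenius:
  fixes F :: "('a::{field,finite}, 'n::finite) mpoly \<Rightarrow> ('a, 'n) mpoly"
  assumes "qpoly m F"
  shows "qpoly (Suc m) (\<lambda>t. F t ^ CARD('a))"
proof -
  obtain e where e: "\<And>t. F t = (\<Sum>k<m. e k * t ^ (CARD('a) ^ k))"
    using assms by (auto simp: qpoly_def)
  have "(\<Sum>k<m. e k * t ^ (CARD('a) ^ k)) ^ CARD('a)
    = (\<Sum>k<Suc m. (case k of 0 \<Rightarrow> 0 | Suc k' \<Rightarrow> e k' ^ CARD('a)) * t ^ (CARD('a) ^ k))" for t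
    using frobenius_sum[of "\<lambda>k. e k * t ^ (CARD('a) ^ k)" "{..<m}" 1]
    by (simp add: sum.lessThan_Suc_shift power_mult_distrib mult.commute flip: power_mult del: sum.lessThan_Suc)
  then show ?thesis
    unfolding qpoly_def e by (intro exI allI)
qed

text \<open>Unique coordinates along \<open>b\<close> turn counts and products over a span into
  iterated ones, which drives the inductions on a basis.\<close>

lemma bij_betw_span_insert:
  assumes "b \<notin> vec.span B"
  shows "bij_betw (\<lambda>(c, w). c *s b + w) (UNIV \<times> vec.span B) (vec.span (insert b B))"
proof (rule bij_betw_imageI)
  show "inj_on (\<lambda>(c, w). c *s b + w) (UNIV \<times> vec.span B)"
  proof (rule inj_onI, clarsimp)
    fix c w c' w'
    assume w: "w \<in> vec.span B" "w' \<in> vec.span B" and eq: "c *s b + w = c' *s b + w'"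
    then have "(c - c') *s b = w' - w"
      by (simp add: vec.scale_left_diff_distrib algebra_simps)
    then have "(c - c') *s b \<in> vec.span B"
      using w by (simp add: vec.span_diff)
    \<comment> \<open>If c \<noteq> c', dividing by c - c' puts \<open>b\<close> into the
      span.\<close>
    then have "inverse (c - c') *s ((c - c') *s b) \<in> vec.span B"
      by (rule vec.span_scale)
    then have "c = c'"
      using assms by (cases "c = c'") simp_all
    then show "c = c' \<and> w = w'"
      using eq by simp
  qed
  show "(\<lambda>(c, w). c *s b + w) ` (UNIV \<times> vec.span B) = vec.span (insert b B)"
  proof (intro equalityI subsetI)
    fix x
    assume "x \<in> vec.span (insert b B)"
    then obtain c where "x - c *s b \<in> vec.span B"
      by (auto simp: vec.span_insert)
    then show "x \<in> (\<lambda>(c, w). c *s b + w) ` (UNIV \<times> vec.span B)"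
      by (intro image_eqI[of _ _ "(c, x - c *s b)"]) auto
  next
    fix x
    assume "x \<in> (\<lambda>(c, w). c *s b + w) ` (UNIV \<times> vec.span B)"
    then obtain c w where "x = c *s b + w" "w \<in> vec.span B"
      by auto
    then show "x \<in> vec.span (insert b B)"
      unfolding vec.span_insert by (auto intro!: exI[of _ c])
  qed
qed

lemma card_span:
  fixes B :: "('a::{field,finite} ^ 'n::finite) set"
  assumes "vec.independent B"
  shows "card (vec.span B) = CARD('a) ^ card B"
  using finite[of B] assms
proof (induction B)
  case (insert b B)
  then have "vec.independent B" "b \<notin> vec.span B"
    by (auto simp: vec.independent_insert)
  then show ?case
    using insert bij_betw_same_card[OF bij_betw_span_insert[of b B]]
    by (simp add: card_cartesian_product)
qed simp

text \<open>The subspace polynomial F of a span. Adjoining \<open>b\<close>, additivity gives the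
  product over c of F(t) + c F(b), which is F(t)^q - F(b)^(q-1) F(t) by
  \<open>prod_add_scalar_multiples\<close>.\<close>

lemma qpoly_prod_span:
  fixes B :: "('a::{field,finite} ^ 'n::finite) set"
  assumes "vec.independent B"
  shows "qpoly (Suc (card B)) (\<lambda>t. \<Prod>w\<in>vec.span B. t + lin_poly w)"
  using finite[of B] assms
proof (induction B)
  case empty
  then show ?case
    by (auto simp: qpoly_def intro!: exI[of _ "\<lambda>_. 1"])
next
  case (insert b B)
  let ?F = "\<lambda>t. \<Prod>w\<in>vec.span B. t + lin_poly w"
  have B: "vec.independent B" "b \<notin> vec.span B"
    using insert by (auto simp: vec.independent_insert)
  have F: "qpoly (Suc (card B)) ?F"
    using insert B by simp
  have "(\<Prod>w\<in>vec.span (insert b B). t + lin_poly w) = ?F t ^ CARD('a) + - (?F (lin_poly b) ^ (CARD('a) - 1)) * ?F t" for t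
  proof -
    have "(\<Prod>w\<in>vec.span (insert b B). t + lin_poly w)
      = (\<Prod>(c, w)\<in>UNIV \<times> vec.span B. t + lin_poly (c *s b + w))"
      using prod.reindex_bij_betw[OF bij_betw_span_insert[OF B(2)], of "\<lambda>w. t + lin_poly w"]
      by (simp add: case_prod_unfold)
    also have "\<dots> = (\<Prod>c\<in>UNIV. ?F (t + mconst c * lin_poly b))"
      by (simp add: prod.cartesian_product lin_poly_add lin_poly_scale add_ac)
    also have "\<dots> = (\<Prod>c\<in>UNIV. ?F t + mconst c * ?F (lin_poly b))"
      by (simp only: qpoly_additive[OF F] qpoly_scale[OF F])
    finally show ?thesis
      by (simp add: prod_add_scalar_multiples)
  qed
  then show ?case
    using insert.hyps qpoly_add[OF qpoly_frobenius[OF F] qpoly_mult[OF qpoly_mono[OF F]],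
        of "- (?F (lin_poly b) ^ (CARD('a) - 1))"]
    by simp
qed

text \<open>If \<open>\<delta>\<close> already vanishes on the span of \<open>B\<close>, all \<open>lin_poly (b + w)\<close> divide \<open>\<delta> b\<close>, and so
  does their product, which is the value of a \<open>q\<close>-polynomial.\<close>

lemma full_log_deriv_on_span:
  fixes B :: "('a::{field,finite} ^ 'n::finite) set"
  assumes "vec.independent B" "\<And>w. w \<in> vec.span B \<Longrightarrow> lin_poly w dvd apply_deriv_lin \<delta> w"
  shows "\<exists>G. qpoly (card B) G \<and> (\<forall>w\<in>vec.span B. apply_deriv_lin \<delta> w = G (lin_poly w))"
  using finite[of B] assms
proof (induction B)
  case empty
  show ?case
    by (intro exI[of _ "\<lambda>_. 0"]) (simp add: qpoly_def)
next
  case (insert b B)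
  have B: "vec.independent B" "b \<notin> vec.span B"
    using insert by (auto simp: vec.independent_insert)
  have sub: "vec.span B \<subseteq> vec.span (insert b B)"
    by (rule vec.span_mono) auto
  obtain G where G: "qpoly (card B) G" "\<And>w. w \<in> vec.span B \<Longrightarrow> apply_deriv_lin \<delta> w = G (lin_poly w)"
    using insert.IH[OF B(1)] insert.prems(2) sub by blast
  obtain e where e: "\<And>t. G t = (\<Sum>k<card B. e k * t ^ (CARD('a) ^ k))"
    using G(1) by (auto simp: qpoly_def)
  let ?F = "\<lambda>t. \<Prod>w\<in>vec.span B. t + lin_poly w"
  have F: "qpoly (Suc (card B)) ?F"
    using B(1) by (rule qpoly_prod_span)
  \<comment> \<open>Subtracting the \<open>q\<close>-polynomial found for \<open>B\<close> produces
    the vanishing on its span; \<epsilon> is still linear and still divisible by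
    \<open>lin_poly w\<close>.\<close>
  define \<epsilon> where "\<epsilon> w = apply_deriv_lin \<delta> w - G (lin_poly w)" for w
  have \<epsilon>_add: "\<epsilon> (v + w) = \<epsilon> v + \<epsilon> w" for v w
    by (simp add: \<epsilon>_def apply_deriv_lin_add lin_poly_add qpoly_additive[OF G(1)])
  have \<epsilon>_scale: "\<epsilon> (c *s w) = mconst c * \<epsilon> w" for c w
    by (simp add: \<epsilon>_def apply_deriv_lin_scale lin_poly_scale qpoly_scale[OF G(1)] right_diff_distrib)
  have \<epsilon>_0: "\<epsilon> w = 0" if "w \<in> vec.span B" for w
    using G(2)[OF that] by (simp add: \<epsilon>_def)
  have \<epsilon>_dvd: "lin_poly w dvd \<epsilon> w" if "w \<in> vec.span (insert b B)" for w
  proof -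
    have "lin_poly w dvd G (lin_poly w)"
      unfolding e by (intro dvd_sum dvd_mult dvd_power) simp
    then show ?thesis
      using insert.prems(2)[OF that] by (simp add: \<epsilon>_def)
  qed
  have nz: "b + w \<noteq> 0" if "w \<in> vec.span B" for w
    using B(2) that by (metis add_eq_0_iff2 vec.span_neg)
  have "?F (lin_poly b) dvd \<epsilon> b"
  proof (rule prod_prime_elem_dvd)
    fix w
    assume w: "w \<in> vec.span B"
    then show "prime_elem (lin_poly b + lin_poly w)"
      using prime_elem_lin_poly[OF nz] by (simp add: lin_poly_add)
    have "b + w \<in> vec.span (insert b B)"
      using vec.span_add[OF vec.span_base[of b "insert b B"]] w sub by blast
    then show "lin_poly b + lin_poly w dvd \<epsilon> b"
      using \<epsilon>_dvd[of "b + w"] \<epsilon>_0[OF w] by (simp add: \<epsilon>_add lin_poly_add)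
    fix v
    assume v: "v \<in> vec.span B" and "w \<noteq> v"
    show "\<not> lin_poly b + lin_poly w dvd lin_poly b + lin_poly v"
    proof
      assume "lin_poly b + lin_poly w dvd lin_poly b + lin_poly v"
      then have "lin_poly (b + w) dvd lin_poly (b + v)"
        by (simp add: lin_poly_add)
      then obtain c where "b + v = c *s (b + w)"
        using lin_poly_dvd_lin_polyD[OF nz[OF w]] by metis
      then have "1 *s b + v = c *s b + c *s w"
        by (simp add: vec.scale_right_distrib)
      \<comment> \<open>Coordinates along \<open>b\<close> are unique.\<close>
      then have "c = 1" "v = c *s w"
        using bij_betw_imp_inj_on[OF bij_betw_span_insert[OF B(2)]] v w vec.span_scale[OF w, of c]
        unfolding inj_on_def by (metis (no_types, lifting) SigmaI UNIV_I case_prod_conv prod.inject)+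
      with \<open>w \<noteq> v\<close> show False
        by simp
    qed
  qed simp
  then obtain g where g: "\<epsilon> b = g * ?F (lin_poly b)"
    by (metis dvd_def mult.commute)
  have F_0: "?F (lin_poly w) = 0" if "w \<in> vec.span B" for w
  proof -
    have "\<exists>v\<in>vec.span B. lin_poly w + lin_poly v = 0"
      using that by (intro bexI[of _ "- w"]) (auto simp: vec.span_neg simp flip: lin_poly_add)
    then show ?thesis
      by (intro prod_zero) auto
  qed
  \<comment> \<open>Adding g F keeps the values on the span of \<open>B\<close>, where F vanishes,
    and corrects the value at \<open>b\<close>; linearity does the rest.\<close>
  show ?case
  proof (intro exI[of _ "\<lambda>t. G t + g * ?F t"] conjI ballI)
    show "qpoly (card (insert b B)) (\<lambda>t. G t + g * ?F t)"
      using insert.hyps qpoly_add[OF qpoly_mono[OF G(1)] qpoly_mult[OF F]] by simp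
    fix x
    assume "x \<in> vec.span (insert b B)"
    then obtain c w where x: "x = c *s b + w" and w: "w \<in> vec.span B"
      unfolding bij_betw_imp_surj_on[OF bij_betw_span_insert[OF B(2)], symmetric] by auto
    have "\<epsilon> x = mconst c * (g * ?F (lin_poly b))"
      using \<epsilon>_0[OF w] g by (simp add: x \<epsilon>_add \<epsilon>_scale)
    also have "\<dots> = g * ?F (lin_poly x)"
      by (simp only: x lin_poly_add lin_poly_scale qpoly_additive[OF F] qpoly_scale[OF F] F_0[OF w]
          mult.left_commute[of g] add_0_right)
    finally show "apply_deriv_lin \<delta> x = G (lin_poly x) + g * ?F (lin_poly x)"
      by (simp add: \<epsilon>_def algebra_simps)
  qed
qed

text \<open>As a polynomial in t the sum has degree below q^|B|, yet the q^|B| forms from the span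
  are roots.\<close>

lemma qpoly_coeffs_unique:
  fixes B :: "('a::{field,finite} ^ 'n::finite) set"
  assumes "vec.independent B" "\<And>w. w \<in> vec.span B \<Longrightarrow> (\<Sum>k<card B. e k * lin_poly w ^ (CARD('a) ^ k)) = 0"
    and "k < card B"
  shows "e k = 0"
proof -
  let ?q = "CARD('a)"
  let ?P = "\<Sum>k<card B. monom (number_vars (e k)) (?q ^ k)"
  have q: "1 < ?q"
    by (rule CARD_field_gt_1)
  have "?P = 0"
  proof (rule poly_eqI_degree[where A = "(number_vars \<circ> lin_poly) ` vec.span B"])
    have "card ((number_vars \<circ> lin_poly) ` vec.span B) = ?q ^ card B"
      using assms(1) by (subst card_image) (auto simp: card_span intro!: inj_onI)
    moreover have "degree ?P \<le> ?q ^ card B - 1"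
    proof (rule degree_sum_le)
      fix k
      assume "k \<in> {..<card B}"
      then have "?q ^ k < ?q ^ card B"
        using q by (simp add: power_strict_increasing)
      then show "degree (monom (number_vars (e k)) (?q ^ k)) \<le> ?q ^ card B - 1"
        by (intro order.trans[OF degree_monom_le]) simp
    qed simp
    ultimately show "degree ?P < card ((number_vars \<circ> lin_poly) ` vec.span B)"
      "degree 0 < card ((number_vars \<circ> lin_poly) ` vec.span B)"
      using q by (simp_all add: order.strict_trans1)
    fix z
    assume "z \<in> (number_vars \<circ> lin_poly) ` vec.span B"
    then obtain w where w: "w \<in> vec.span B" "z = number_vars (lin_poly w)"
      by auto
    have "poly ?P z = number_vars (\<Sum>k<card B. e k * lin_poly w ^ (?q ^ k))"
      by (simp add: w poly_sum poly_monom number_vars_def msubst_sum msubst_mult msubst_power)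
    then show "poly ?P z = poly 0 z"
      using assms(2)[OF w(1)] by simp
  qed
  \<comment> \<open>q > 1 makes the exponents q^k distinct, so only one summand contributes.\<close>
  moreover have "coeff ?P (?q ^ k) = (\<Sum>i<card B. if i = k then number_vars (e i) else 0)"
    unfolding coeff_sum coeff_monom using q by (intro sum.cong) auto
  ultimately show ?thesis
    using assms(3) by simp
qed

section \<open>Hyperplanes\<close>

lemma subspace_lin_ker: "vec.subspace (lin_ker a)"
proof (rule vec.subspaceI)
  fix c x
  assume "x \<in> lin_ker a"
  moreover have "(\<Sum>i\<in>UNIV. a $ i * (c *s x) $ i) = c * (\<Sum>i\<in>UNIV. a $ i * x $ i)"
    by (simp add: sum_distrib_left mult.left_commute)
  ultimately show "c *s x \<in> lin_ker a"
    by (simp add: lin_ker_def)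
qed (simp_all add: lin_ker_def distrib_left sum.distrib)

lemma lin_ker_scale: "c \<noteq> 0 \<Longrightarrow> lin_ker (c *s a) = lin_ker a"
  unfolding lin_ker_def by (simp add: mult.assoc flip: sum_distrib_left)

lemma sum_mult_axis [simp]:
  fixes b :: "'a::field ^ 'n::finite"
  shows "(\<Sum>i\<in>UNIV. b $ i * axis k c $ i) = b $ k * c"
proof -
  have "(\<Sum>i\<in>UNIV. b $ i * axis k c $ i) = (\<Sum>i\<in>UNIV. if i = k then b $ i * c else 0)"
    by (intro sum.cong) (auto simp: axis_def)
  then show ?thesis
    by simp
qed

lemma lin_ker_subsetD:
  fixes a b :: "'a::field ^ 'n::finite"
  assumes "a \<noteq> 0" "lin_ker a \<subseteq> lin_ker b"
  obtains c where "b = c *s a"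
proof -
  obtain j where j: "a $ j \<noteq> 0"
    using assms(1) by (rule vec_nonzero_nth)
  have "b $ k = b $ j / a $ j * a $ k" for k
  proof -
    \<comment> \<open>A vector chosen in the kernel of \<open>a\<close>; that \<open>b\<close>
      vanishes on it determines b_k.\<close>
    have "axis k 1 - axis j (a $ k / a $ j) \<in> lin_ker a"
      using j by (simp add: lin_ker_def right_diff_distrib sum_subtractf)
    then have "axis k 1 - axis j (a $ k / a $ j) \<in> lin_ker b"
      using assms(2) by blast
    then show ?thesis
      by (simp add: lin_ker_def right_diff_distrib sum_subtractf mult_ac)
  qed
  then have "b = (b $ j / a $ j) *s a"
    unfolding vec_eq_iff vector_smult_component by (rule allI)
  then show ?thesis
    by (rule that)
qed

lemma lin_ker_neq_UNIV:
  fixes a :: "'a::field ^ 'n::finite"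
  assumes "a \<noteq> 0"
  shows "lin_ker a \<noteq> UNIV"
proof -
  obtain j where "a $ j \<noteq> 0"
    using assms by (rule vec_nonzero_nth)
  then have "axis j 1 \<notin> lin_ker a"
    by (simp add: lin_ker_def)
  then show ?thesis
    by blast
qed

lemma alpha_hyperplane:
  assumes "is_hyperplane H"
  shows "alpha H \<noteq> 0" "lin_ker (alpha H) = H"
proof -
  have "alpha H \<noteq> 0 \<and> H = lin_ker (alpha H)"
    unfolding alpha_def using assms[unfolded is_hyperplane_def] by (rule someI_ex)
  then show "alpha H \<noteq> 0" "lin_ker (alpha H) = H"
    by metis+
qed

text \<open>Forms with the same kernel are proportional, so the choice made in \<open>alpha\<close>
  does not matter.\<close>

lemma logder_iff:
  fixes A :: "('a::field ^ 'n::finite) set set"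
  assumes "central_arrangement A"
  shows "\<delta> \<in> logder A \<longleftrightarrow> (\<forall>a. a \<noteq> 0 \<longrightarrow> lin_ker a \<in> A \<longrightarrow> lin_poly a dvd apply_deriv_lin \<delta> a)"
proof
  assume \<delta>: "\<delta> \<in> logder A"
  show "\<forall>a. a \<noteq> 0 \<longrightarrow> lin_ker a \<in> A \<longrightarrow> lin_poly a dvd apply_deriv_lin \<delta> a"
  proof (intro allI impI)
    fix a :: "'a ^ 'n"
    assume a: "a \<noteq> 0" "lin_ker a \<in> A"
    let ?b = "alpha (lin_ker a)"
    have b: "?b \<noteq> 0" "lin_ker ?b = lin_ker a"
      using alpha_hyperplane a by (auto simp: is_hyperplane_def)
    then obtain c where c: "a = c *s ?b"
      using lin_ker_subsetD[of ?b a] by auto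
    then have "c \<noteq> 0"
      using a by auto
    have "lin_poly ?b dvd apply_deriv_lin \<delta> ?b"
      using \<delta> a by (simp add: logder_def)
    then have "mconst c * lin_poly ?b dvd mconst c * apply_deriv_lin \<delta> ?b"
      by (rule mult_dvd_mono[OF dvd_refl])
    then show "lin_poly a dvd apply_deriv_lin \<delta> a"
      using c by (metis lin_poly_scale apply_deriv_lin_scale)
  qed
next
  assume "\<forall>a. a \<noteq> 0 \<longrightarrow> lin_ker a \<in> A \<longrightarrow> lin_poly a dvd apply_deriv_lin \<delta> a"
  then show "\<delta> \<in> logder A"
    using assms by (simp add: logder_def central_arrangement_def alpha_hyperplane)
qed

text \<open>Each hyperplane is the kernel of exactly q - 1 of the q^\<ell> - 1 nonzero forms; the
  quotient is a geometric sum.\<close>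

lemma card_hyperplanes:
  "card {H :: ('a::{field,finite} ^ 'n::finite) set. is_hyperplane H} = (\<Sum>k<CARD('n). CARD('a) ^ k)"
proof -
  let ?q = "CARD('a)" and ?N = "card {H :: ('a ^ 'n) set. is_hyperplane H}"
  have q: "1 < ?q"
    by (rule CARD_field_gt_1)
  have hyp: "lin_ker ` (UNIV - {0 :: 'a ^ 'n}) = {H. is_hyperplane H}"
    by (auto simp: is_hyperplane_def)
  have fibre: "card {b \<in> UNIV - {0}. lin_ker b = lin_ker a} = ?q - 1" if a: "a \<noteq> 0" for a :: "'a ^ 'n"
  proof -
    have "{b \<in> UNIV - {0}. lin_ker b = lin_ker a} = (\<lambda>c. c *s a) ` (UNIV - {0})"
    proof (intro equalityI subsetI)
      fix b
      assume b: "b \<in> {b \<in> UNIV - {0}. lin_ker b = lin_ker a}"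
      then obtain c where "b = c *s a"
        using lin_ker_subsetD[OF a, of b] by auto
      then show "b \<in> (\<lambda>c. c *s a) ` (UNIV - {0})"
        using b by (intro image_eqI[of _ _ c]) auto
    qed (use that in \<open>auto simp: lin_ker_scale\<close>)
    moreover have "inj (\<lambda>c. c *s a)"
      using that by (auto intro!: injI)
    ultimately show ?thesis
      by (simp add: card_image inj_on_subset[of _ UNIV] card_Diff_singleton)
  qed
  have "card (UNIV - {0 :: 'a ^ 'n}) = (\<Sum>H\<in>{H. is_hyperplane H}. card {b \<in> UNIV - {0 :: 'a ^ 'n}. lin_ker b = H})"
    using sum.image_gen[of "UNIV - {0 :: 'a ^ 'n}" "\<lambda>_. 1 :: nat" lin_ker] by (simp add: hyp)
  also have "\<dots> = (\<Sum>H\<in>{H :: ('a ^ 'n) set. is_hyperplane H}. ?q - 1)"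
    by (rule sum.cong) (use fibre in \<open>auto simp: is_hyperplane_def\<close>)
  finally have "?q ^ CARD('n) - 1 = ?N * (?q - 1)"
    by (simp add: card_Diff_singleton)
  then have "int (?q ^ CARD('n) - 1) = int ?N * int (?q - 1)"
    by (metis of_nat_mult)
  then have "int ?q ^ CARD('n) - 1 = int ?N * (int ?q - 1)"
    using q by (simp add: of_nat_diff)
  then have "(int ?q - 1) * int ?N = (int ?q - 1) * (\<Sum>k<CARD('n). int ?q ^ k)"
    using power_diff_1_eq[of "int ?q" "CARD('n)"] by (simp only: mult.commute[of "int ?N"])
  then have "int ?N = int (\<Sum>k<CARD('n). ?q ^ k)"
    using q by simp
  then show ?thesis
    by (simp only: of_nat_eq_iff)
qed

section \<open>The characteristic polynomial counts tuples\<close>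

lemma card_subspace:
  fixes X :: "('a::{field,finite} ^ 'n::finite) set"
  assumes "vec.subspace X"
  shows "card X = CARD('a) ^ vec.dim X"
proof -
  obtain B where B: "B \<subseteq> X" "vec.independent B" "X \<subseteq> vec.span B" "card B = vec.dim X"
    using vec.basis_exists by blast
  then have "vec.span B = X"
    using assms by (simp add: vec.span_subspace)
  then show ?thesis
    using card_span[OF B(2)] B(4) by simp
qed

lemma UNIV_in_int_lattice [simp]: "UNIV \<in> int_lattice A"
  by (auto simp: int_lattice_def intro!: exI[of _ "{}"])

text \<open>The recursion for \<mu> as a total function, terminating because complements shrink
  along proper supersets. It supplies existence for the definite description in
  \<open>moebius\<close>.\<close>

function moebius_rec :: "('a::finite ^ 'n::finite) set set \<Rightarrow> ('a ^ 'n) set \<Rightarrow> int" where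
  "moebius_rec L X = (if X = UNIV then 1
     else if X \<in> L then - (\<Sum>Y\<in>{Y \<in> L. X \<subset> Y}. moebius_rec L Y) else 0)"
  by auto
termination
  by (relation "measure (\<lambda>(L, X). card (- X))") (auto intro!: psubset_card_mono)

declare moebius_rec.simps [simp del]

lemma moebius_eq_moebius_rec:
  fixes A :: "('a::{field,finite} ^ 'n::finite) set set"
  shows "moebius A = moebius_rec (int_lattice A)"
  unfolding moebius_def
proof (rule the_equality)
  let ?L = "int_lattice A"
  show "moebius_rec ?L UNIV = 1 \<and>
    (\<forall>X\<in>?L. X \<noteq> UNIV \<longrightarrow> moebius_rec ?L X = - (\<Sum>Y\<in>{Y \<in> ?L. X \<subset> Y}. moebius_rec ?L Y)) \<and>
    (\<forall>X. X \<notin> ?L \<longrightarrow> moebius_rec ?L X = 0)"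
  proof (intro conjI ballI allI impI)
    show "moebius_rec ?L X = 0" if "X \<notin> ?L" for X
      using that UNIV_in_int_lattice[of A] by (subst moebius_rec.simps) metis
  qed (subst moebius_rec.simps, simp)+
  fix f :: "('a ^ 'n) set \<Rightarrow> int"
  assume f: "f UNIV = 1 \<and> (\<forall>X\<in>?L. X \<noteq> UNIV \<longrightarrow> f X = - (\<Sum>Y\<in>{Y \<in> ?L. X \<subset> Y}. f Y)) \<and>
    (\<forall>X. X \<notin> ?L \<longrightarrow> f X = 0)"
  have "f X = moebius_rec ?L X" for X
  proof (induction "card (- X)" arbitrary: X rule: less_induct)
    case less
    have "(\<Sum>Y\<in>{Y \<in> ?L. X \<subset> Y}. f Y) = (\<Sum>Y\<in>{Y \<in> ?L. X \<subset> Y}. moebius_rec ?L Y)"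
      by (rule sum.cong) (auto intro!: less psubset_card_mono)
    then show ?case
      using f by (subst moebius_rec.simps) auto
  qed
  then show "f = moebius_rec ?L"
    by blast
qed

text \<open>The defining recursion with \<mu>(Z) brought to the other side.\<close>

lemma sum_moebius_above:
  fixes A :: "('a::{field,finite} ^ 'n::finite) set set"
  assumes "Z \<in> int_lattice A"
  shows "(\<Sum>X\<in>{X \<in> int_lattice A. Z \<subseteq> X}. moebius A X) = (if Z = UNIV then 1 else 0)"
proof -
  let ?L = "int_lattice A"
  have "{X \<in> ?L. Z \<subseteq> X} = insert Z {X \<in> ?L. Z \<subset> X}"
    using assms by auto
  then have "(\<Sum>X\<in>{X \<in> ?L. Z \<subseteq> X}. moebius A X) = moebius A Z + (\<Sum>X\<in>{X \<in> ?L. Z \<subset> X}. moebius A X)"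
    by simp
  also have "\<dots> = (if Z = UNIV then 1 else 0)"
    unfolding moebius_eq_moebius_rec
    by (subst moebius_rec.simps) (use assms in auto)
  finally show ?thesis .
qed

lemma subspace_int_lattice:
  assumes "central_arrangement A" "X \<in> int_lattice A"
  shows "vec.subspace X"
proof -
  obtain B where "B \<subseteq> A" "X = \<Inter>B"
    using assms(2) by (auto simp: int_lattice_def)
  moreover have "vec.subspace H" if "H \<in> A" for H
    using assms(1) that by (auto simp: central_arrangement_def is_hyperplane_def subspace_lin_ker)
  ultimately show ?thesis
    by (auto intro: vec.subspace_Inter)
qed

text \<open>q^(s dim X) counts the s-tuples in X. After exchanging sums, a tuple contributes the sum
  of \<mu> over the flats containing it, which is 1 or 0 by
  \<open>sum_moebius_above\<close>.\<close>

theorem poly_char_poly_power: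
  fixes A :: "('a::{field,finite} ^ 'n::finite) set set"
  assumes "central_arrangement A"
  shows "poly (char_poly A) (int CARD('a) ^ s)
    = int (card {xs. length xs = s \<and> (\<forall>H\<in>A. \<not> set xs \<subseteq> H)})"
proof -
  let ?L = "int_lattice A"
  let ?T = "{xs :: ('a ^ 'n) list. length xs = s}"
  have fin: "finite ?T"
    using finite_lists_length_eq[of "UNIV :: ('a ^ 'n) set" s] by simp
  have count: "(int CARD('a) ^ s) ^ vec.dim X = (\<Sum>xs\<in>?T. if set xs \<subseteq> X then 1 else 0)" if "X \<in> ?L" for X
  proof -
    have "(CARD('a) ^ s) ^ vec.dim X = card X ^ s"
      using card_subspace[OF subspace_int_lattice[OF assms that]] by (simp add: mult.commute flip: power_mult)
    also have "\<dots> = card {xs. set xs \<subseteq> X \<and> length xs = s}"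
      by (simp add: card_lists_length_eq)
    also have "{xs. set xs \<subseteq> X \<and> length xs = s} = {xs \<in> ?T. set xs \<subseteq> X}"
      by auto
    finally have "int ((CARD('a) ^ s) ^ vec.dim X) = int (card {xs \<in> ?T. set xs \<subseteq> X})"
      by (rule arg_cong)
    then show ?thesis
      using fin by (simp add: sum.If_cases Int_def)
  qed
  have above: "(\<Sum>X\<in>?L. if set xs \<subseteq> X then moebius A X else 0) = (if \<forall>H\<in>A. \<not> set xs \<subseteq> H then 1 else 0)" for xs
  proof -
    \<comment> \<open>The smallest flat containing the tuple. It is V exactly when no member of
      \<open>A\<close> contains the tuple.\<close>
    let ?Z = "\<Inter>{H \<in> A. set xs \<subseteq> H}"
    have Z: "?Z \<in> ?L"
      by (auto simp: int_lattice_def)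
    have "set xs \<subseteq> X \<longleftrightarrow> ?Z \<subseteq> X" if "X \<in> ?L" for X
    proof
      obtain B where B: "B \<subseteq> A" "X = \<Inter>B"
        using \<open>X \<in> ?L\<close> by (auto simp: int_lattice_def)
      show "?Z \<subseteq> X" if "set xs \<subseteq> X"
        using B that by blast
      show "set xs \<subseteq> X" if "?Z \<subseteq> X"
        using that by blast
    qed
    then have "(\<Sum>X\<in>?L. if set xs \<subseteq> X then moebius A X else 0) = (\<Sum>X\<in>{X \<in> ?L. ?Z \<subseteq> X}. moebius A X)"
      by (intro sum.mono_neutral_cong_right) auto
    moreover have "?Z = UNIV \<longleftrightarrow> (\<forall>H\<in>A. \<not> set xs \<subseteq> H)"
    proof
      assume Z: "?Z = UNIV"
      show "\<forall>H\<in>A. \<not> set xs \<subseteq> H"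
      proof (intro ballI notI)
        fix H
        assume "H \<in> A" "set xs \<subseteq> H"
        then have "H = UNIV" "is_hyperplane H"
          using Z assms by (auto simp: central_arrangement_def)
        then show False
          using lin_ker_neq_UNIV by (metis is_hyperplane_def)
      qed
    qed auto
    ultimately show ?thesis
      using sum_moebius_above[OF Z] by simp
  qed
  have "poly (char_poly A) (int CARD('a) ^ s) = (\<Sum>X\<in>?L. moebius A X * (int CARD('a) ^ s) ^ vec.dim X)"
    by (simp add: char_poly_def poly_sum poly_monom)
  also have "\<dots> = (\<Sum>X\<in>?L. \<Sum>xs\<in>?T. if set xs \<subseteq> X then moebius A X else 0)"
    by (intro sum.cong refl) (simp add: count sum_distrib_left if_distrib cong: if_cong)
  also have "\<dots> = (\<Sum>xs\<in>?T. \<Sum>X\<in>?L. if set xs \<subseteq> X then moebius A X else 0)"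
    by (rule sum.swap)
  also have "\<dots> = int (card {xs. length xs = s \<and> (\<forall>H\<in>A. \<not> set xs \<subseteq> H)})"
    using fin by (simp add: above sum.If_cases Int_def)
  finally show ?thesis .
qed

text \<open>A line-blocking set of the dual projective space, stated by vectors: \<ell>-2
  independent vectors are annihilated by the forms on a projective line. For \<ell> = 2 the list is
  empty and the condition says that \<open>A\<close> is nonempty.\<close>

definition blocking :: "('a::field ^ 'n::finite) set set \<Rightarrow> bool" where
  "blocking A \<longleftrightarrow> (\<forall>xs. length xs = CARD('n) - 2 \<longrightarrow> (\<exists>H\<in>A. set xs \<subseteq> H))"

lemma blocking_mono: "blocking A \<Longrightarrow> A \<subseteq> A' \<Longrightarrow> blocking A'"
  unfolding blocking_def by (metis subsetD)

lemma blocking_if_char_poly_zero: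
  fixes A :: "('a::{field,finite} ^ 'n::finite) set set"
  assumes "central_arrangement A" "poly (char_poly A) (int CARD('a) ^ (CARD('n) - 2)) = 0"
  shows "blocking A"
proof -
  let ?s = "CARD('n) - 2"
  have "finite {xs :: ('a ^ 'n) list. length xs = ?s}"
    using finite_lists_length_eq[of "UNIV :: ('a ^ 'n) set" ?s] by simp
  then have "finite {xs. length xs = ?s \<and> (\<forall>H\<in>A. \<not> set xs \<subseteq> H)}"
    by (rule rev_finite_subset) auto
  then have "{xs. length xs = ?s \<and> (\<forall>H\<in>A. \<not> set xs \<subseteq> H)} = {}"
    using assms(2) unfolding poly_char_poly_power[OF assms(1)] by simp
  then show ?thesis
    by (auto simp: blocking_def)
qed

text \<open>Dually, a blocking arrangement meets the line through any two points \<open>a\<close> and \<open>b\<close> of the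
  projective space of linear forms.\<close>

lemma blocking_line:
  fixes A :: "('a::field ^ 'n::finite) set set"
  assumes "blocking A" "central_arrangement A" "a $ j \<noteq> 0" "b $ j = 0" "b \<noteq> 0"
  obtains x y where "x *s a + y *s b \<noteq> 0" "lin_ker (x *s a + y *s b) \<in> A"
proof -
  obtain i where i: "b $ i \<noteq> 0"
    using assms(5) by (rule vec_nonzero_nth)
  then have ij: "i \<noteq> j"
    using assms(4) by auto
  \<comment> \<open>e_k is corrected at i to make \<open>b\<close> vanish and then at j to make
    \<open>a\<close> vanish; \<open>b $ j = 0\<close> keeps the second correction from spoiling the
    first.\<close>
  define u where "u k = axis k 1 - axis i (b $ k / b $ i) - axis j ((a $ k - b $ k / b $ i * a $ i) / a $ j)" for k
  obtain ks where ks: "set ks = UNIV - {i, j}" "distinct ks"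
    using finite_distinct_list[of "UNIV - {i, j}"] by auto
  then have "length ks = CARD('n) - 2"
    using ij by (simp add: card_Diff_subset flip: distinct_card)
  then obtain H where H: "H \<in> A" "set (map u ks) \<subseteq> H"
    using assms(1) by (metis blocking_def length_map)
  then obtain c where c: "c \<noteq> 0" "H = lin_ker c"
    using assms(2) by (auto simp: central_arrangement_def is_hyperplane_def)
  \<comment> \<open>As \<open>b $ j = 0\<close>, coordinate j fixes x, and coordinate i then fixes
    y; the other coordinates follow because \<open>c\<close> vanishes on \<open>u k\<close>.\<close>
  define x where "x = c $ j / a $ j"
  define y where "y = (c $ i - x * a $ i) / b $ i"
  have "c $ k = x * a $ k + y * b $ k" for k
  proof (cases "k \<in> {i, j}")
    case True
    then show ?thesis
      using i assms(3,4) by (auto simp: x_def y_def)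
  next
    case False
    then have "u k \<in> lin_ker c"
      using H ks c by auto
    then have "c $ k - c $ i * (b $ k / b $ i) - c $ j * ((a $ k - b $ k / b $ i * a $ i) / a $ j) = 0"
      unfolding lin_ker_def u_def mem_Collect_eq vector_minus_component right_diff_distrib[of "c $ _"]
        sum_subtractf sum_mult_axis by simp
    then have "c $ k = c $ i * (b $ k / b $ i) + c $ j * ((a $ k - b $ k / b $ i * a $ i) / a $ j)"
      by (simp only: diff_diff_eq right_minus_eq)
    then show ?thesis
      using i assms(3) by (simp add: x_def y_def field_simps)
  qed
  then have "c = x *s a + y *s b"
    by (simp add: vec_eq_iff)
  then show ?thesis
    using c H by (intro that[of x y]) auto
qed

section \<open>Deleting hyperplanes from the full arrangement\<close>

text \<open>For \<open>a $ j \<noteq> 0\<close> the span of \<open>axes (UNIV - {j})\<close>, the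
  forms without x_j, is a complement of \<open>a\<close> and models the dual space of
  \<open>lin_ker a\<close>.\<close>

definition axes :: "'n set \<Rightarrow> ('a::field ^ 'n::finite) set" where
  "axes K = (\<lambda>i. axis i 1) ` K"

lemma independent_axes: "vec.independent (axes K)"
  by (rule vec.independent_mono[OF independent_cart_basis]) (auto simp: axes_def cart_basis_def)

lemma card_axes: "card (axes K :: ('a::field ^ 'n::finite) set) = card K"
  by (auto simp: axes_def axis_eq_axis intro!: card_image inj_onI)

lemma span_axes_UNIV: "vec.span (axes UNIV) = UNIV"
  using span_cart_basis by (simp add: axes_def cart_basis_def full_SetCompr_eq)

lemma nth_span_axes:
  fixes w :: "'a::field ^ 'n::finite"
  assumes "w \<in> vec.span (axes K)" "j \<notin> K"
  shows "w $ j = 0"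
proof -
  have "axes K \<subseteq> {w :: 'a ^ 'n. w $ j = 0}"
    using assms(2) by (auto simp: axes_def axis_def)
  then have "vec.span (axes K) \<subseteq> {w :: 'a ^ 'n. w $ j = 0}"
    by (rule vec.span_minimal) (auto intro!: vec.subspaceI)
  then show ?thesis
    using assms(1) by auto
qed

section \<open>Combinations of the \<theta>_k and the bases they extend to\<close>

lemma apply_frob_comb:
  fixes w :: "'a::{field,finite} ^ 'n::finite"
  shows "apply_deriv_lin (\<lambda>i. \<Sum>k<m. c k * frob_deriv k i) w = (\<Sum>k<m. c k * lin_poly w ^ (CARD('a) ^ k))"
  by (simp add: apply_deriv_lin_fun_sum apply_deriv_lin_fun_mult apply_frob_deriv)

lemma lin_poly_dvd_frob_comb:
  fixes w :: "'a::{field,finite} ^ 'n::finite"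
  shows "lin_poly w dvd (\<Sum>k<m. c k * lin_poly w ^ (CARD('a) ^ k))"
  by (intro dvd_sum dvd_mult dvd_power) simp

lemma mhomog_frob_deriv: "mhomog (CARD('a) ^ k) (frob_deriv k i :: ('a::{field,finite}, 'n::finite) mpoly)"
  by (simp add: frob_deriv_def mhomog_mvar_power)

lemma homogeneous_frob_deriv:
  "homogeneous_deriv (frob_deriv k :: ('a::{field,finite}, 'n::finite) deriv) (CARD('a) ^ k)"
proof -
  have "frob_deriv k i \<noteq> (0 :: ('a, 'n) mpoly)" for i
    by (metis frob_deriv_def mvar_power lookup_single_eq lookup_zero zero_neq_one)
  then show ?thesis
    using mhomog_frob_deriv[where 'a = 'a and 'n = 'n] by (auto simp: homogeneous_deriv_def mhomog_def)
qed

lemma frob_deriv_in_logder: "frob_deriv k \<in> logder A"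
  by (auto simp: logder_def apply_frob_deriv intro!: dvd_power)

text \<open>\<theta>_0, ..., \<theta>_(\<ell>-2) and \<theta> form a basis of D(A). Coefficients are
  functions rather than lists, which eases changing them.\<close>

definition completes_basis :: "('a::{field,finite} ^ 'n::finite) set set \<Rightarrow> ('a, 'n) deriv \<Rightarrow> bool" where
  "completes_basis A \<theta> \<longleftrightarrow> \<theta> \<in> logder A
    \<and> (\<forall>c e. (\<forall>i. (\<Sum>k<CARD('n) - 1. c k * frob_deriv k i) + e * \<theta> i = 0) \<longrightarrow> e = 0 \<and> (\<forall>k<CARD('n) - 1. c k = 0))
    \<and> (\<forall>\<eta>\<in>logder A. \<exists>c e. \<forall>i. \<eta> i = (\<Sum>k<CARD('n) - 1. c k * frob_deriv k i) + e * \<theta> i)"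

lemma deriv_comb_snoc:
  "deriv_comb cs (map f [0..<m] @ [\<theta>]) i = (\<Sum>k<m. cs ! k * f k i) + cs ! m * \<theta> i"
  by (simp add: deriv_comb_def nth_append)

lemma is_S_basis_if_completes_basis:
  fixes A :: "('a::{field,finite} ^ 'n::finite) set set"
  assumes "completes_basis A \<theta>"
  shows "is_S_basis (logder A) (map frob_deriv [0..<CARD('n) - 1] @ [\<theta>])"
proof -
  let ?m = "CARD('n) - 1"
  let ?ths = "map frob_deriv [0..<?m] @ [\<theta>]"
  show ?thesis
    unfolding is_S_basis_def
  proof (intro conjI allI impI ballI)
    show "set ?ths \<subseteq> logder A"
      using assms by (auto simp: completes_basis_def frob_deriv_in_logder)
  next
    fix cs :: "('a, 'n) mpoly list" and c
    assume cs: "length cs = length ?ths" "\<forall>i. deriv_comb cs ?ths i = 0" "c \<in> set cs"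
    then have "cs ! ?m = 0 \<and> (\<forall>k<?m. cs ! k = 0)"
      using assms unfolding completes_basis_def deriv_comb_snoc by blast
    moreover obtain k where "k < Suc ?m" "c = cs ! k"
      using cs by (auto simp: in_set_conv_nth)
    ultimately show "c = 0"
      using less_antisym[of k ?m] by metis
  next
    fix \<eta>
    assume "\<eta> \<in> logder A"
    then obtain c e where ce: "\<And>i. \<eta> i = (\<Sum>k<?m. c k * frob_deriv k i) + e * \<theta> i"
      using assms unfolding completes_basis_def by blast
    let ?cs = "map c [0..<?m] @ [e]"
    have "\<eta> = deriv_comb ?cs ?ths"
      unfolding deriv_comb_snoc fun_eq_iff ce by (simp add: nth_append)
    then show "\<exists>cs. length cs = length ?ths \<and> \<eta> = deriv_comb cs ?ths"
      by (intro exI[of _ ?cs]) simp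
  qed
qed

text \<open>Start of the deletions. Independence is uniqueness of \<open>q\<close>-polynomial
  coefficients; generation is \<open>full_log_deriv_on_span\<close> for the standard basis, read off
  at coordinate forms.\<close>

lemma completes_basis_full:
  "completes_basis {H :: ('a::{field,finite} ^ 'n::finite) set. is_hyperplane H} (frob_deriv (CARD('n) - 1))"
  unfolding completes_basis_def
proof (intro conjI allI impI ballI)
  let ?A = "{H :: ('a ^ 'n) set. is_hyperplane H}"
  let ?n = "CARD('n)"
  have n: "?n = Suc (?n - 1)"
    by simp
  have B: "vec.independent (axes UNIV :: ('a ^ 'n) set)" "card (axes UNIV :: ('a ^ 'n) set) = ?n"
    by (simp_all add: independent_axes card_axes)
  show "frob_deriv (?n - 1) \<in> logder ?A"
    by (rule frob_deriv_in_logder)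
  have "e = 0 \<and> (\<forall>k<?n - 1. c k = 0)"
    if *: "\<forall>i. (\<Sum>k<?n - 1. c k * frob_deriv k i) + e * frob_deriv (?n - 1) i = (0 :: ('a, 'n) mpoly)" for c e
  proof -
    define c' where "c' k = (if k = ?n - 1 then e else c k)" for k
    have "(\<Sum>k<?n - 1. c' k * frob_deriv k i) = (\<Sum>k<?n - 1. c k * frob_deriv k i)" for i :: 'n
      by (rule sum.cong) (auto simp: c'_def)
    then have "(\<Sum>k<Suc (?n - 1). c' k * frob_deriv k i) = 0" for i :: 'n
      using * unfolding sum.lessThan_Suc by (simp add: c'_def)
    then have "apply_deriv_lin (\<lambda>i. \<Sum>k<?n. c' k * frob_deriv k i) w = 0" for w :: "'a ^ 'n"
      unfolding n[symmetric] by (simp add: apply_deriv_lin_def)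
    then have "c' k = 0" if "k < ?n" for k
      using qpoly_coeffs_unique[OF B(1), of c' k] that unfolding B(2) apply_frob_comb by blast
    then have "c' (?n - 1) = 0" "\<And>k. k < ?n - 1 \<Longrightarrow> c' k = 0"
      by simp_all
    then show ?thesis
      by (auto simp: c'_def split: if_splits)
  qed
  then show "e = 0" "\<And>k. k < ?n - 1 \<Longrightarrow> c k = 0"
    if "\<forall>i. (\<Sum>k<?n - 1. c k * frob_deriv k i) + e * frob_deriv (?n - 1) i = (0 :: ('a, 'n) mpoly)" for c e
    using that by blast+
  fix \<eta>
  assume \<eta>: "\<eta> \<in> logder ?A"
  have "lin_poly w dvd apply_deriv_lin \<eta> w" for w
  proof (cases "w = 0")
    case False
    then show ?thesis
      using \<eta> by (subst (asm) logder_iff) (auto simp: central_arrangement_def is_hyperplane_def)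
  qed simp
  then obtain G where G: "qpoly ?n G" "\<And>w. apply_deriv_lin \<eta> w = G (lin_poly w)"
    using full_log_deriv_on_span[OF B(1), of \<eta>] unfolding B(2) span_axes_UNIV by blast
  obtain c where c: "\<And>t. G t = (\<Sum>k<Suc (?n - 1). c k * t ^ (CARD('a) ^ k))"
    using G(1) unfolding n[symmetric] by (auto simp: qpoly_def)
  have "\<eta> i = (\<Sum>k<?n - 1. c k * frob_deriv k i) + c (?n - 1) * frob_deriv (?n - 1) i" for i
    using G(2)[of "axis i 1"] unfolding c sum.lessThan_Suc by (simp add: frob_deriv_def)
  then show "\<exists>c e. \<forall>i. \<eta> i = (\<Sum>k<?n - 1. c k * frob_deriv k i) + e * frob_deriv (?n - 1) i"
    by blast
qed

text \<open>Restricted to the hyperplane \<open>lin_ker a\<close>, a derivation as below is logarithmic for the full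
  arrangement of the hyperplane, because every line through \<open>a\<close> meets \<open>A\<close>.\<close>

lemma restrict_to_hyperplane:
  fixes A :: "('a::{field,finite} ^ 'n::finite) set set"
  assumes A: "central_arrangement A" "blocking A" and a: "a \<noteq> 0" "lin_ker a \<notin> A"
    and \<delta>: "\<delta> \<in> logder (insert (lin_ker a) A)"
  shows "\<exists>g. \<forall>i. lin_poly a dvd \<delta> i - (\<Sum>k<CARD('n) - 1. g k * frob_deriv k i)"
proof -
  obtain j where j: "a $ j \<noteq> 0"
    using a(1) by (rule vec_nonzero_nth)
  let ?\<phi> = "elim_var a j"
  let ?B = "axes (UNIV - {j}) :: ('a ^ 'n) set"
  have cB: "card ?B = CARD('n) - 1"
    by (simp add: card_axes card_Diff_singleton)
  have "central_arrangement (insert (lin_ker a) A)"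
    using A(1) a(1) by (auto simp: central_arrangement_def is_hyperplane_def)
  note \<delta>_dvd = \<delta>[unfolded logder_iff[OF this], rule_format]
  have \<phi>a: "?\<phi> (apply_deriv_lin \<delta> a) = 0"
    using \<delta>_dvd[of a] a(1) lin_poly_dvd_iff[OF j] by simp
  have "lin_poly w dvd apply_deriv_lin (\<lambda>i. ?\<phi> (\<delta> i)) w" if w: "w \<in> vec.span ?B" for w
  proof (cases "w = 0")
    case False
    have wj: "w $ j = 0"
      using w by (rule nth_span_axes) simp
    obtain x y where xy: "x *s a + y *s w \<noteq> 0" "lin_ker (x *s a + y *s w) \<in> A"
      using blocking_line[OF A(2,1) j wj False] by blast
    \<comment> \<open>For y = 0 the point would be \<open>a\<close> itself, whose kernel is not in
      \<open>A\<close>.\<close>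
    have y: "y \<noteq> 0"
      using xy a(2) by (cases "x = 0") (auto simp: lin_ker_scale)
    \<comment> \<open>Modulo \<open>a\<close> the summand x a disappears on both sides, since
      \<open>a\<close> divides \<delta>(a).\<close>
    have "?\<phi> (lin_poly (x *s a + y *s w)) dvd ?\<phi> (apply_deriv_lin \<delta> (x *s a + y *s w))"
      using \<delta>_dvd[OF xy(1)] xy(2) by (auto elim!: dvdE simp: elim_var_hom)
    then have "mconst y * lin_poly w dvd mconst y * ?\<phi> (apply_deriv_lin \<delta> w)"
      using wj j by (simp add: lin_poly_add lin_poly_scale apply_deriv_lin_add apply_deriv_lin_scale
          elim_var_hom \<phi>a elim_var_lin_poly[of a j w])
    then have "mconst (inverse y) * (mconst y * lin_poly w) dvd mconst (inverse y) * (mconst y * ?\<phi> (apply_deriv_lin \<delta> w))"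
      by (rule mult_dvd_mono[OF dvd_refl])
    then show ?thesis
      using y by (simp add: elim_var_apply_deriv_lin flip: mult.assoc mconst_mult)
  qed simp
  then obtain G where G: "qpoly (CARD('n) - 1) G"
    "\<And>w. w \<in> vec.span ?B \<Longrightarrow> apply_deriv_lin (\<lambda>i. ?\<phi> (\<delta> i)) w = G (lin_poly w)"
    using full_log_deriv_on_span[OF independent_axes[of "UNIV - {j}"], of "\<lambda>i. ?\<phi> (\<delta> i)"] cB by metis
  obtain g where g: "\<And>t. G t = (\<Sum>k<CARD('n) - 1. g k * t ^ (CARD('a) ^ k))"
    using G(1) by (auto simp: qpoly_def)
  define \<eta> where "\<eta> i = \<delta> i - (\<Sum>k<CARD('n) - 1. g k * frob_deriv k i)" for i
  have off: "?\<phi> (\<eta> i) = 0" if "i \<noteq> j" for i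
  proof -
    have "axis i 1 \<in> vec.span ?B"
      using that by (intro vec.span_base) (auto simp: axes_def)
    from G(2)[OF this] have "?\<phi> (\<delta> i) = (\<Sum>k<CARD('n) - 1. g k * mvar i ^ (CARD('a) ^ k))"
      by (simp add: g)
    \<comment> \<open>The g_k may involve x_j; applying the idempotent \<open>?\<phi>\<close> again
      reduces them and leaves the left-hand side unchanged.\<close>
    then have "?\<phi> (?\<phi> (\<delta> i)) = ?\<phi> (\<Sum>k<CARD('n) - 1. g k * mvar i ^ (CARD('a) ^ k))"
      by simp
    then show ?thesis
      using j by (simp add: \<eta>_def elim_var_hom frob_deriv_def)
  qed
  \<comment> \<open>Only the coefficient at j is left: \<open>a\<close> divides \<eta>(a), and
    modulo \<open>a\<close> just the term a_j \<eta>_j of it survives.\<close>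
  have "lin_poly a dvd apply_deriv_lin \<eta> a"
    unfolding \<eta>_def apply_deriv_lin_fun_diff apply_frob_comb
    using \<delta>_dvd[OF a(1)] lin_poly_dvd_frob_comb by (intro dvd_diff) auto
  then have "?\<phi> (apply_deriv_lin \<eta> a) = 0"
    using lin_poly_dvd_iff[OF j] by simp
  then have "(\<Sum>i\<in>UNIV. mconst (a $ i) * ?\<phi> (\<eta> i)) = 0"
    by (simp add: apply_deriv_lin_def elim_var_hom)
  moreover have "(\<Sum>i\<in>UNIV. mconst (a $ i) * ?\<phi> (\<eta> i)) = (\<Sum>i\<in>{j}. mconst (a $ i) * ?\<phi> (\<eta> i))"
    by (rule sum.mono_neutral_right) (auto simp: off)
  ultimately have "mconst (a $ j) * ?\<phi> (\<eta> j) = 0"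
    by simp
  moreover have "mconst (a $ j) \<noteq> (0 :: ('a, 'n) mpoly)"
    using j mconst_inject[of "a $ j" 0] by simp
  ultimately have "?\<phi> (\<eta> i) = 0" for i
    using off by (cases "i = j") (auto simp: mpoly_mult_eq_0_iff)
  then have "lin_poly a dvd \<eta> i" for i
    using lin_poly_dvd_iff[OF j] by simp
  then show ?thesis
    unfolding \<eta>_def by blast
qed

text \<open>Independence of the \<theta>_k modulo \<open>a\<close>: the reduced coefficients give a
  \<open>q\<close>-polynomial with \<ell>-1 terms that vanishes on the (\<ell>-1)-dimensional space
  of forms without x_j.\<close>

lemma frob_comb_dvd_coeffs:
  fixes a :: "'a::{field,finite} ^ 'n::finite"
  assumes "a \<noteq> 0" "\<And>i. lin_poly a dvd (\<Sum>k<CARD('n) - 1. c k * frob_deriv k i)" "k < CARD('n) - 1"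
  shows "lin_poly a dvd c k"
proof -
  obtain j where j: "a $ j \<noteq> 0"
    using assms(1) by (rule vec_nonzero_nth)
  let ?B = "axes (UNIV - {j}) :: ('a ^ 'n) set"
  have cB: "card ?B = CARD('n) - 1"
    by (simp add: card_axes card_Diff_singleton)
  have "(\<Sum>k<CARD('n) - 1. elim_var a j (c k) * lin_poly w ^ (CARD('a) ^ k)) = 0" if "w \<in> vec.span ?B" for w
  proof -
    have "w $ j = 0"
      using that by (rule nth_span_axes) simp
    then have "elim_var a j (lin_poly w) = lin_poly w"
      by (simp add: elim_var_lin_poly)
    then have "(\<Sum>k<CARD('n) - 1. elim_var a j (c k) * lin_poly w ^ (CARD('a) ^ k))
        = elim_var a j (apply_deriv_lin (\<lambda>i. \<Sum>k<CARD('n) - 1. c k * frob_deriv k i) w)"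
      by (simp add: apply_frob_comb elim_var_hom)
    also have "\<dots> = 0"
      using assms(2) by (simp add: elim_var_apply_deriv_lin lin_poly_dvd_iff[OF j]) (simp add: apply_deriv_lin_def)
    finally show ?thesis .
  qed
  then have "elim_var a j (c k) = 0"
    using qpoly_coeffs_unique[OF independent_axes[of "UNIV - {j}"], of "\<lambda>k. elim_var a j (c k)" k] assms(3)
    unfolding cB by blast
  then show ?thesis
    by (simp add: lin_poly_dvd_iff[OF j])
qed

lemma delete_hyperplane:
  fixes A :: "('a::{field,finite} ^ 'n::finite) set set"
  assumes A: "central_arrangement A" "blocking A" and a: "a \<noteq> 0" "lin_ker a \<notin> A"
    and \<theta>: "completes_basis (insert (lin_ker a) A) \<theta>" "homogeneous_deriv \<theta> d"
  shows "\<exists>\<theta>' d'. d = Suc d' \<and> homogeneous_deriv \<theta>' d' \<and> completes_basis A \<theta>'"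
proof -
  let ?m = "CARD('n) - 1" and ?a = "lin_poly a" and ?q = "CARD('a)"
  have A': "central_arrangement (insert (lin_ker a) A)"
    using A(1) a(1) by (auto simp: central_arrangement_def is_hyperplane_def)
  have \<theta>_log: "\<theta> \<in> logder (insert (lin_ker a) A)"
    and \<theta>_indep: "\<And>c e. (\<And>i. (\<Sum>k<?m. c k * frob_deriv k i) + e * \<theta> i = 0) \<Longrightarrow> e = 0 \<and> (\<forall>k<?m. c k = 0)"
    and \<theta>_span: "\<And>\<eta>. \<eta> \<in> logder (insert (lin_ker a) A) \<Longrightarrow> \<exists>c e. \<forall>i. \<eta> i = (\<Sum>k<?m. c k * frob_deriv k i) + e * \<theta> i"
    using \<theta>(1) unfolding completes_basis_def by blast+
  obtain g where "\<And>i. ?a dvd \<theta> i - (\<Sum>k<?m. g k * frob_deriv k i)"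
    using restrict_to_hyperplane[OF A a \<theta>_log] by blast
  then obtain r where r: "\<And>i. \<theta> i - (\<Sum>k<?m. g k * frob_deriv k i) = ?a * r i"
    unfolding dvd_def by metis
  \<comment> \<open>Taking degree d parts of \<theta> = \<Sum> g_k \<theta>_k + a r makes \<theta>'
    homogeneous; where the complementary degree would be negative, the part is 0.\<close>
  define c where "c k = (if ?q ^ k \<le> d then hcomp (d - ?q ^ k) (g k) else 0)" for k
  define \<theta>' where "\<theta>' i = (if 1 \<le> d then hcomp (d - 1) (r i) else 0)" for i
  have \<theta>_eq: "\<theta> i = (\<Sum>k<?m. c k * frob_deriv k i) + ?a * \<theta>' i" for i
  proof -
    have "mhomog d (\<theta> i)"
      using \<theta>(2) by (simp add: homogeneous_deriv_def mhomog_def)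
    then have "\<theta> i = hcomp d (\<theta> i)"
      by (simp add: hcomp_homog)
    also have "hcomp d (\<theta> i) = hcomp d ((\<Sum>k<?m. g k * frob_deriv k i) + r i * ?a)"
      using r[of i] by (simp add: algebra_simps)
    also have "\<dots> = (\<Sum>k<?m. hcomp d (g k * frob_deriv k i)) + hcomp d (r i * ?a)"
      by (simp add: hcomp_add hcomp_sum)
    also have "\<dots> = (\<Sum>k<?m. c k * frob_deriv k i) + ?a * \<theta>' i"
      unfolding hcomp_mult_homog[OF mhomog_frob_deriv] hcomp_mult_homog[OF mhomog_lin_poly]
      by (intro arg_cong2[where f = plus] sum.cong) (auto simp: c_def \<theta>'_def)
    finally show ?thesis .
  qed
  \<comment> \<open>Otherwise \<theta> would be a combination of the \<theta>_k. This also gives d >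
    0, as \<theta>' is 0 by definition for d = 0.\<close>
  have "\<exists>i. \<theta>' i \<noteq> 0"
  proof (rule ccontr)
    assume "\<not> ?thesis"
    then have "(\<Sum>k<?m. - c k * frob_deriv k i) + 1 * \<theta> i = 0" for i
      using \<theta>_eq[of i] by (simp add: sum_negf)
    then have "1 = (0 :: ('a, 'n) mpoly)"
      using \<theta>_indep[of "\<lambda>k. - c k" 1] by blast
    then show False
      by simp
  qed
  then obtain d' where d': "d = Suc d'" and \<theta>'_hom: "homogeneous_deriv \<theta>' d'"
    using mhomog_hcomp[of "d - 1"]
    by (cases d) (auto simp: \<theta>'_def homogeneous_deriv_def mhomog_def)
  have "?a \<noteq> 0"
    using a(1) by simp
  have "\<theta>' \<in> logder A"
    unfolding logder_iff[OF A(1)]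
  proof (intro allI impI)
    fix b
    assume b: "b \<noteq> 0" "lin_ker b \<in> A"
    have "apply_deriv_lin \<theta> b = (\<Sum>k<?m. c k * lin_poly b ^ (?q ^ k)) + ?a * apply_deriv_lin \<theta>' b"
      unfolding \<theta>_eq[abs_def] apply_deriv_lin_fun_add apply_frob_comb apply_deriv_lin_fun_mult ..
    moreover have "lin_poly b dvd apply_deriv_lin \<theta> b"
      using \<theta>_log b unfolding logder_iff[OF A'] by blast
    ultimately have "lin_poly b dvd ?a * apply_deriv_lin \<theta>' b"
      by (simp only: dvd_add_right_iff[OF lin_poly_dvd_frob_comb])
    \<comment> \<open>A prime form not dividing \<open>?a\<close> must divide the other factor;
      proportionality would put \<open>lin_ker a\<close> into \<open>A\<close>.\<close>
    moreover have "\<not> lin_poly b dvd ?a"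
    proof
      assume "lin_poly b dvd ?a"
      then obtain x where x: "a = x *s b"
        using lin_poly_dvd_lin_polyD[OF b(1)] by metis
      then have "x \<noteq> 0"
        using a(1) by auto
      then have "lin_ker a = lin_ker b"
        unfolding x by (rule lin_ker_scale)
      then show False
        using a(2) b(2) by simp
    qed
    ultimately show "lin_poly b dvd apply_deriv_lin \<theta>' b"
      using prime_elem_lin_poly[OF b(1)] by (auto dest: prime_elem_dvd_multD)
  qed
  moreover have "e = 0 \<and> (\<forall>k<?m. x k = 0)"
    if *: "\<forall>i. (\<Sum>k<?m. x k * frob_deriv k i) + e * \<theta>' i = 0" for x e
  proof -
    \<comment> \<open>Multiplying by \<open>?a\<close> and replacing a \<theta>' by \<theta> -
      \<Sum> c_k \<theta>_k gives a relation for the old basis.\<close>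
    have "(\<Sum>k<?m. (?a * x k - e * c k) * frob_deriv k i) + e * \<theta> i
      = ?a * ((\<Sum>k<?m. x k * frob_deriv k i) + e * \<theta>' i)" for i
      unfolding \<theta>_eq[of i] by (simp add: sum_subtractf sum_distrib_left algebra_simps)
    then have "(\<Sum>k<?m. (?a * x k - e * c k) * frob_deriv k i) + e * \<theta> i = 0" for i
      using * by simp
    then have "e = 0 \<and> (\<forall>k<?m. ?a * x k - e * c k = 0)"
      by (rule \<theta>_indep)
    then show ?thesis
      using \<open>?a \<noteq> 0\<close> by (auto simp: mpoly_mult_eq_0_iff)
  qed
  moreover have "\<exists>x e. \<forall>i. \<eta> i = (\<Sum>k<?m. x k * frob_deriv k i) + e * \<theta>' i" if \<eta>: "\<eta> \<in> logder A" for \<eta>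
  proof -
    \<comment> \<open>The multiple a \<eta> is logarithmic also along \<open>lin_ker a\<close>, so
      it expands in the old basis; the resulting \<theta>_k part is divisible by \<open>?a\<close>,
      and cancelling expresses \<eta> in the new basis.\<close>
    have "(\<lambda>i. ?a * \<eta> i) \<in> logder (insert (lin_ker a) A)"
      unfolding logder_iff[OF A'] apply_deriv_lin_fun_mult
    proof (intro allI impI)
      fix b
      assume b: "b \<noteq> 0" "lin_ker b \<in> insert (lin_ker a) A"
      show "lin_poly b dvd ?a * apply_deriv_lin \<eta> b"
      proof (cases "lin_ker b = lin_ker a")
        case True
        then obtain x where "a = x *s b"
          using lin_ker_subsetD[OF b(1), of a] by auto
        then have "lin_poly b dvd ?a"
          by (simp add: lin_poly_scale)
        then show ?thesis
          by (rule dvd_mult2)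
      next
        case False
        then show ?thesis
          using \<eta> b unfolding logder_iff[OF A(1)] by (intro dvd_mult) auto
      qed
    qed
    from \<theta>_span[OF this] obtain y e where ye: "\<And>i. ?a * \<eta> i = (\<Sum>k<?m. y k * frob_deriv k i) + e * \<theta> i"
      by blast
    have eq: "?a * \<eta> i = (\<Sum>k<?m. (y k + e * c k) * frob_deriv k i) + ?a * (e * \<theta>' i)" for i
      unfolding ye \<theta>_eq[of i] by (simp add: sum.distrib sum_distrib_left algebra_simps)
    have "?a dvd (\<Sum>k<?m. (y k + e * c k) * frob_deriv k i)" for i
    proof -
      have "(\<Sum>k<?m. (y k + e * c k) * frob_deriv k i) = ?a * (\<eta> i - e * \<theta>' i)"
        using eq[of i] by (simp add: right_diff_distrib)
      then show ?thesis
        by simp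
    qed
    then have "\<forall>k<?m. ?a dvd y k + e * c k"
      using frob_comb_dvd_coeffs[OF a(1), of "\<lambda>k. y k + e * c k"] by blast
    then obtain f where f: "\<And>k. k < ?m \<Longrightarrow> y k + e * c k = ?a * f k"
      unfolding dvd_def by metis
    have "?a * \<eta> i = ?a * ((\<Sum>k<?m. f k * frob_deriv k i) + e * \<theta>' i)" for i
      unfolding eq[of i] by (simp add: f sum_distrib_left distrib_left mult.assoc)
    then have "\<eta> i = (\<Sum>k<?m. f k * frob_deriv k i) + e * \<theta>' i" for i
      using mpoly_mult_left_cancel[OF \<open>?a \<noteq> 0\<close>] by blast
    then show ?thesis
      by blast
  qed
  ultimately have "completes_basis A \<theta>'"
    unfolding completes_basis_def by blast
  then show ?thesis
    using d' \<theta>'_hom by blast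
qed

text \<open>Every intermediate arrangement contains \<open>A\<close>, hence is blocking, so the
  hyperplanes outside \<open>A\<close> can be deleted one by one.\<close>

lemma blocking_completes_basis:
  fixes A :: "('a::{field,finite} ^ 'n::finite) set set"
  assumes "central_arrangement A" "blocking A"
  shows "\<exists>\<theta> d. homogeneous_deriv \<theta> d \<and> completes_basis A \<theta> \<and> d + (\<Sum>k<CARD('n) - 1. CARD('a) ^ k) = card A"
proof -
  let ?U = "{H :: ('a ^ 'n) set. is_hyperplane H}" and ?q = "CARD('a)" and ?m = "CARD('n) - 1"
  \<comment> \<open>The degree starts at q^(\<ell>-1) and drops by one per deletion.\<close>
  have "\<exists>\<theta> d. homogeneous_deriv \<theta> d \<and> completes_basis (?U - D) \<theta> \<and> d + card D = ?q ^ ?m"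
    if "D \<subseteq> ?U - A" for D
    using finite[of D] that
  proof (induction D)
    case empty
    show ?case
      using homogeneous_frob_deriv[of ?m] completes_basis_full by (intro exI conjI) auto
  next
    case (insert H D)
    then obtain \<theta> d where \<theta>: "homogeneous_deriv \<theta> d" "completes_basis (?U - D) \<theta>" "d + card D = ?q ^ ?m"
      by blast
    obtain a where a: "a \<noteq> 0" "H = lin_ker a"
      using insert.prems by (auto simp: is_hyperplane_def)
    have "insert (lin_ker a) (?U - insert H D) = ?U - D"
      using insert a by auto
    moreover have "central_arrangement (?U - insert H D)"
      by (simp add: central_arrangement_def)
    moreover have "A \<subseteq> ?U - insert H D"
      using insert.prems assms(1) by (auto simp: central_arrangement_def)
    then have "blocking (?U - insert H D)"
      using assms(2) blocking_mono by blast
    ultimately obtain \<theta>' d' where "d = Suc d'" "homogeneous_deriv \<theta>' d'" "completes_basis (?U - insert H D) \<theta>'"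
      using delete_hyperplane[of "?U - insert H D" a \<theta> d] a \<theta> by auto
    then show ?case
      using \<theta>(3) insert.hyps by (intro exI[of _ \<theta>'] exI[of _ d']) auto
  qed
  from this[OF order_refl] obtain \<theta> d where \<theta>: "homogeneous_deriv \<theta> d" "completes_basis (?U - (?U - A)) \<theta>"
    "d + card (?U - A) = ?q ^ ?m"
    by blast
  have sub: "A \<subseteq> ?U"
    using assms(1) by (auto simp: central_arrangement_def)
  then have "?U - (?U - A) = A"
    by blast
  \<comment> \<open>All hyperplanes number q^(\<ell>-1) plus the lower powers, which turns the
    invariant into the claimed value of d.\<close>
  moreover have "card (?U - A) + card A = (\<Sum>k<Suc ?m. ?q ^ k)"
    using card_Diff_subset[OF _ sub] card_mono[OF _ sub] card_hyperplanes[where 'a = 'a and 'n = 'n] by simp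
  ultimately show ?thesis
    using \<theta> unfolding sum.lessThan_Suc by (intro exI[of _ \<theta>] exI[of _ d]) auto
qed

theorem mainTheorem7:
  fixes A :: "('a::{field,finite} ^ 'n::finite) set set"
  assumes "CARD('n) \<ge> 2"
    and "central_arrangement A"
    and "poly (char_poly A) (int CARD('a) ^ (CARD('n) - 2)) = 0"
  shows "free_with_exponents A
           (mset (map (\<lambda>k. int CARD('a) ^ k) [0..<CARD('n) - 1]
              @ [int (card A) - 1 - (\<Sum>k=1..CARD('n) - 2. int CARD('a) ^ k)]))"
proof -
  let ?m = "CARD('n) - 1" and ?q = "CARD('a)"
  obtain \<theta> d where \<theta>: "homogeneous_deriv \<theta> d" "completes_basis A \<theta>" "d + (\<Sum>k<?m. ?q ^ k) = card A"
    using blocking_completes_basis[OF assms(2) blocking_if_char_poly_zero[OF assms(2,3)]] by blast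
  let ?ths = "map frob_deriv [0..<?m] @ [\<theta>]" and ?ds = "map (\<lambda>k. ?q ^ k) [0..<?m] @ [d]"
  \<comment> \<open>\<ell> \<ge> 2 makes 0 one of the indices; its summand q^0 is the 1 subtracted
    separately in the last exponent.\<close>
  have "{..<?m} = insert 0 {1..CARD('n) - 2}"
    using assms(1) by auto
  then have "(\<Sum>k<?m. int ?q ^ k) = 1 + (\<Sum>k=1..CARD('n) - 2. int ?q ^ k)"
    by simp
  moreover have "int d + (\<Sum>k<?m. int ?q ^ k) = int (card A)"
    unfolding \<theta>(3)[symmetric] by simp
  ultimately have "int d = int (card A) - 1 - (\<Sum>k=1..CARD('n) - 2. int ?q ^ k)"
    by linarith
  then have "map int ?ds = map (\<lambda>k. int ?q ^ k) [0..<?m] @ [int (card A) - 1 - (\<Sum>k=1..CARD('n) - 2. int ?q ^ k)]"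
    by simp
  moreover have "homogeneous_deriv (?ths ! j) (?ds ! j)" if "j < length ?ths" for j
    using that \<theta>(1) by (auto simp: nth_append homogeneous_frob_deriv)
  moreover have "length ?ds = length ?ths"
    by simp
  ultimately show ?thesis
    unfolding free_with_exponents_def
    using is_S_basis_if_completes_basis[OF \<theta>(2)] by (intro exI[of _ ?ths] exI[of _ ?ds]) presburger
qed

end
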